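(* Let $1\le p\le\infty$, let $E$ be a Banach space and let $K\subset E$. Then $K$ is $p$-compact in $E$ if and only if $K$ (regarded as a subset of $E''$ via the canonical embedding $E\hookrightarrow E''$) is $p$-compact in $E''$, and $\mathfrak m_p(K;E)=\mathfrak m_p(K;E'')$.
   Context: For a Banach space $E$ and $1\le p<\infty$, $\ell_p(E)$ is the space of sequences $(x_n)_n$ in $E$ with $\|(x_n)_n\|_p=(\sum_n\|x_n\|^p)^{1/p}<\infty$; for $p=\infty$ it is replaced by $c_0(E)$ (norm null sequences) with the supremum norm. With $\frac1p+\frac1{p'}=1$, the $p$-convex hull of $(x_n)_n\in\ell_p(E)$ is $p\text{-}\mathrm{co}\{x_n\}=\{\sum_{n=1}^\infty\alpha_nx_n:(\alpha_n)_n\in B_{\ell_{p'}}\}$, where $\ell_{p'}$ is replaced by $c_0$ if $p=1$. A subset $K\subset E$ is called (relatively) $p$-compact in $E$ if there is $(x_n)_n\in\ell_p(E)$ with $K\subset p\text{-}\mathrm{co}\{x_n\}$ ($K$ is not required to be closed). One sets $\mathfrak m_p(K;E)=\inf\{\|(x_n)_n\|_{\ell_p(E)}: K\subset p\text{-}\mathrm{co}\{x_n\}\}$ if $K$ is $p$-compact in $E$, and $\mathfrak m_p(K;E)=\infty$ otherwise. $E''$ is the bidual of $E$. *)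

theory Defs
  imports "HOL-Analysis.Analysis"
begin

section \<open>Complex Banach spaces and their duals\<close>

text \<open>
  The library class \<open>banach\<close> is the class of real Banach spaces. Complex Banach spaces are real
  Banach spaces with a compatible complex scalar multiplication.
\<close>

class complex_banach = banach +
  fixes scaleC :: "complex \<Rightarrow> 'a \<Rightarrow> 'a"  (infixr "*\<^sub>C" 75)
  assumes scaleC_add_right: "c *\<^sub>C (x + y) = c *\<^sub>C x + c *\<^sub>C y"
    and scaleC_add_left: "(c + d) *\<^sub>C x = c *\<^sub>C x + d *\<^sub>C x"
    and scaleC_scaleC: "c *\<^sub>C d *\<^sub>C x = (c * d) *\<^sub>C x"
    and scaleC_of_real: "complex_of_real r *\<^sub>C x = r *\<^sub>R x"
    and norm_scaleC: "norm (c *\<^sub>C x) = cmod c * norm x"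

instantiation complex :: complex_banach
begin
definition scaleC_complex :: "complex \<Rightarrow> complex \<Rightarrow> complex" where "scaleC_complex = (*)"
instance
  by standard (simp_all add: scaleC_complex_def algebra_simps norm_mult scaleR_conv_of_real)
end

text \<open>
  The dual of a real Banach space is the library type \<open>'a \<Rightarrow>\<^sub>L real\<close> with the operator norm. The
  dual of a complex Banach space consists of the complex-linear elements of \<open>'a \<Rightarrow>\<^sub>L complex\<close>,
  again with the operator norm.
\<close>

typedef (overloaded) 'a cdual =
  "{f :: 'a::complex_banach \<Rightarrow>\<^sub>L complex. \<forall>c x. blinfun_apply f (c *\<^sub>C x) = c * blinfun_apply f x}"
  morphisms cdual_blinfun Abs_cdual
  by (rule exI[of _ 0]) simp

setup_lifting type_definition_cdual

lift_definition cdual_apply :: "'a::complex_banach cdual \<Rightarrow> 'a \<Rightarrow> complex" is blinfun_apply .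

lemma norm_blinfun_mult_right_compose:
  fixes f :: "'a::real_normed_vector \<Rightarrow>\<^sub>L complex"
  shows "norm (blinfun_mult_right c o\<^sub>L f) = cmod c * norm f"
proof (cases "c = 0")
  case True
  then have "blinfun_mult_right c o\<^sub>L f = 0"
    by (auto intro!: blinfun_eqI)
  then show ?thesis using True by simp
next
  case False
  have le: "norm (blinfun_mult_right d o\<^sub>L g) \<le> cmod d * norm g"
    for d and g :: "'a \<Rightarrow>\<^sub>L complex"
  proof (rule norm_blinfun_bound)
    fix x
    have "cmod d * norm (blinfun_apply g x) \<le> cmod d * (norm g * norm x)"
      by (intro mult_left_mono norm_blinfun) auto
    then show "norm (blinfun_apply (blinfun_mult_right d o\<^sub>L g) x) \<le> cmod d * norm g * norm x"
      by (simp add: norm_mult mult.assoc)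
  qed simp
  have "f = blinfun_mult_right (inverse c) o\<^sub>L (blinfun_mult_right c o\<^sub>L f)"
    using False by (auto intro!: blinfun_eqI)
  then have "norm f \<le> cmod (inverse c) * norm (blinfun_mult_right c o\<^sub>L f)"
    using le by metis
  then have "cmod c * norm f \<le> norm (blinfun_mult_right c o\<^sub>L f)"
    using False by (simp add: norm_inverse pos_divide_le_eq norm_divide field_simps)
  with le[of c f] show ?thesis by simp
qed

instantiation cdual :: (complex_banach) real_normed_vector
begin

lift_definition zero_cdual :: "'a cdual" is 0 by simp
lift_definition plus_cdual :: "'a cdual \<Rightarrow> 'a cdual \<Rightarrow> 'a cdual" is "(+)"
  by (simp add: blinfun.add_left algebra_simps)
lift_definition minus_cdual :: "'a cdual \<Rightarrow> 'a cdual \<Rightarrow> 'a cdual" is "(-)"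
  by (simp add: blinfun.diff_left algebra_simps)
lift_definition uminus_cdual :: "'a cdual \<Rightarrow> 'a cdual" is uminus
  by (simp add: blinfun.minus_left)
lift_definition scaleR_cdual :: "real \<Rightarrow> 'a cdual \<Rightarrow> 'a cdual" is scaleR
  by (simp add: blinfun.scaleR_left)
lift_definition norm_cdual :: "'a cdual \<Rightarrow> real" is norm .

definition dist_cdual :: "'a cdual \<Rightarrow> 'a cdual \<Rightarrow> real"
  where "dist_cdual f g = norm (f - g)"
definition sgn_cdual :: "'a cdual \<Rightarrow> 'a cdual"
  where "sgn_cdual f = inverse (norm f) *\<^sub>R f"
definition [code del]:
  "(uniformity :: ('a cdual \<times> 'a cdual) filter) = (INF e\<in>{0 <..}. principal {(x, y). dist x y < e})"
definition open_cdual :: "'a cdual set \<Rightarrow> bool"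
  where "open_cdual U = (\<forall>x\<in>U. \<forall>\<^sub>F (x', y) in uniformity. x' = x \<longrightarrow> y \<in> U)"

instance
  by standard
     (simp_all only: dist_cdual_def sgn_cdual_def uniformity_cdual_def open_cdual_def,
      (transfer; simp add: algebra_simps norm_triangle_ineq)+)

end

instantiation cdual :: (complex_banach) complex_banach
begin

lift_definition scaleC_cdual :: "complex \<Rightarrow> 'a cdual \<Rightarrow> 'a cdual"
  is "\<lambda>c f. blinfun_mult_right c o\<^sub>L f"
  by (simp add: algebra_simps)

instance
proof
  fix c d :: complex and f g :: "'a cdual" and r :: real
  show "c *\<^sub>C (f + g) = c *\<^sub>C f + c *\<^sub>C g"
    by transfer (auto intro!: blinfun_eqI simp: blinfun.add_left algebra_simps)
  show "(c + d) *\<^sub>C f = c *\<^sub>C f + d *\<^sub>C f"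
    by transfer (auto intro!: blinfun_eqI simp: blinfun.add_left algebra_simps)
  show "c *\<^sub>C d *\<^sub>C f = (c * d) *\<^sub>C f"
    by transfer (auto intro!: blinfun_eqI simp: algebra_simps)
  show "complex_of_real r *\<^sub>C f = r *\<^sub>R f"
    by transfer (auto intro!: blinfun_eqI simp: blinfun.scaleR_left scaleR_conv_of_real)
  show "norm (c *\<^sub>C f) = cmod c * norm f"
    by transfer (rule norm_blinfun_mult_right_compose)
next
  fix X :: "nat \<Rightarrow> 'a cdual"
  assume "Cauchy X"
  have dist: "dist (cdual_blinfun f) (cdual_blinfun g) = dist f g" for f g :: "'a cdual"
    unfolding dist_norm by transfer simp
  have "Cauchy (\<lambda>n. cdual_blinfun (X n))"
    using \<open>Cauchy X\<close> by (simp add: Cauchy_def dist)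
  then obtain F where F: "(\<lambda>n. cdual_blinfun (X n)) \<longlonglongrightarrow> F"
    using convergent_eq_Cauchy by blast
  have ev: "(\<lambda>n. blinfun_apply (cdual_blinfun (X n)) x) \<longlonglongrightarrow> blinfun_apply F x" for x
    by (intro tendsto_intros F)
  have "blinfun_apply F (c *\<^sub>C x) = c * blinfun_apply F x" for c x
  proof (rule LIMSEQ_unique[OF ev])
    have "blinfun_apply (cdual_blinfun (X n)) (c *\<^sub>C x) = c * blinfun_apply (cdual_blinfun (X n)) x"
      for n using cdual_blinfun[of "X n"] by simp
    then show "(\<lambda>n. blinfun_apply (cdual_blinfun (X n)) (c *\<^sub>C x)) \<longlonglongrightarrow> c * blinfun_apply F x"
      by (simp add: tendsto_mult_left ev)
  qed
  then have "cdual_blinfun (Abs_cdual F) = F"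
    by (intro Abs_cdual_inverse) simp
  then have "X \<longlonglongrightarrow> Abs_cdual F"
    using F by (simp add: tendsto_dist_iff[of _ "Abs_cdual F"] tendsto_dist_iff[of _ F] flip: dist)
  then show "convergent X"
    by (rule convergentI)
qed

end

section \<open>Canonical embeddings into the bidual\<close>

lift_definition bidual_embed :: "'a::banach \<Rightarrow> ('a \<Rightarrow>\<^sub>L real) \<Rightarrow>\<^sub>L real"
  is "\<lambda>x f. blinfun_apply f x"
  by (rule blinfun.bounded_linear_left)

lemma bounded_linear_cdual_apply: "bounded_linear (\<lambda>f. cdual_apply f x)"
proof (rule bounded_linear_intro)
  show "cdual_apply (f + g) x = cdual_apply f x + cdual_apply g x" for f g
    by transfer (simp add: blinfun.add_left)
  show "cdual_apply (r *\<^sub>R f) x = r *\<^sub>R cdual_apply f x" for r f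
    by transfer (simp add: blinfun.scaleR_left)
  show "norm (cdual_apply f x) \<le> norm f * norm x" for f
    by transfer (rule norm_blinfun)
qed

definition cbidual_embed :: "'a::complex_banach \<Rightarrow> 'a cdual cdual" where
  "cbidual_embed x = Abs_cdual (Blinfun (\<lambda>f. cdual_apply f x))"

lemma cbidual_embed_apply: "cdual_apply (cbidual_embed x) f = cdual_apply f x"
proof -
  let ?F = "Blinfun (\<lambda>f. cdual_apply f x)"
  have F: "blinfun_apply ?F g = cdual_apply g x" for g
    by (simp add: bounded_linear_Blinfun_apply bounded_linear_cdual_apply)
  have "cdual_apply (c *\<^sub>C g) x = c * cdual_apply g x" for c g
    by transfer simp
  then have "cdual_blinfun (Abs_cdual ?F) = ?F"
    by (intro Abs_cdual_inverse) (simp add: F)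
  then show ?thesis
    using F[of f] by (simp add: cbidual_embed_def cdual_apply.rep_eq[of "Abs_cdual ?F"])
qed

section \<open>$p$-compact sets\<close>

text \<open>
  Exponents range over \<open>{1..\<infinity>}\<close> in \<open>ennreal\<close>. For \<open>p = \<infinity>\<close> the space \<open>\<ell>\<^sub>p\<close> is replaced by
  \<open>c\<^sub>0\<close> with the supremum norm, both for vector sequences and for scalar coefficients.
\<close>

definition in_lp :: "ennreal \<Rightarrow> (nat \<Rightarrow> 'a::real_normed_vector) \<Rightarrow> bool" where
  "in_lp p x \<longleftrightarrow>
    (if p = \<infinity> then x \<longlonglongrightarrow> 0 else summable (\<lambda>n. norm (x n) powr enn2real p))"

definition lp_norm :: "ennreal \<Rightarrow> (nat \<Rightarrow> 'a::real_normed_vector) \<Rightarrow> real" where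
  "lp_norm p x =
    (if p = \<infinity> then (SUP n. norm (x n))
     else (\<Sum>n. norm (x n) powr enn2real p) powr (1 / enn2real p))"

text \<open>The solution \<open>p'\<close> of \<open>1/p + 1/p' = 1\<close>, with \<open>1/\<infinity> = 0\<close> and \<open>1/0 = \<infinity>\<close> in \<open>ennreal\<close>.\<close>

definition conj_exponent :: "ennreal \<Rightarrow> ennreal" where
  "conj_exponent p = inverse (1 - inverse p)"

lemma conj_exponent_eq:
  assumes "1 \<le> p"
  shows "inverse p + inverse (conj_exponent p) = 1"
proof -
  have inv_inv: "inverse (inverse q) = q" for q :: ennreal
  proof (cases q)
    case (real r)
    then show ?thesis by (cases "r = 0") (simp_all add: inverse_ennreal)
  qed simp
  have "inverse p \<le> 1"
  proof (cases p)
    case (real r)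
    with assms have "1 \<le> r" by simp
    with real show ?thesis by (simp add: inverse_ennreal inverse_le_1_iff)
  qed simp
  then show ?thesis
    by (simp add: conj_exponent_def inv_inv add_diff_self_ennreal)
qed

lemma conj_exponent_1: "conj_exponent 1 = \<infinity>"
  by (simp add: conj_exponent_def)

lemma conj_exponent_infinity: "conj_exponent \<infinity> = 1"
  by (simp add: conj_exponent_def)

text \<open>
  The scalar multiplication \<open>s\<close> determines the scalar field \<open>'k\<close>; it is \<open>scaleR\<close> for real
  and \<open>scaleC\<close> for complex Banach spaces.
\<close>

definition p_hull ::
  "('k::real_normed_field \<Rightarrow> 'a::banach \<Rightarrow> 'a) \<Rightarrow> ennreal \<Rightarrow> (nat \<Rightarrow> 'a) \<Rightarrow> 'a set" where
  "p_hull s p x =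
    {y. \<exists>\<alpha>. in_lp (conj_exponent p) \<alpha> \<and> lp_norm (conj_exponent p) \<alpha> \<le> 1 \<and>
        (\<lambda>n. s (\<alpha> n) (x n)) sums y}"

definition p_compact ::
  "('k::real_normed_field \<Rightarrow> 'a::banach \<Rightarrow> 'a) \<Rightarrow> ennreal \<Rightarrow> 'a set \<Rightarrow> bool" where
  "p_compact s p K \<longleftrightarrow> (\<exists>x. in_lp p x \<and> K \<subseteq> p_hull s p x)"

definition p_measure ::
  "('k::real_normed_field \<Rightarrow> 'a::banach \<Rightarrow> 'a) \<Rightarrow> ennreal \<Rightarrow> 'a set \<Rightarrow> ennreal" where
  "p_measure s p K =
    (if p_compact s p K
     then Inf {ennreal (lp_norm p x) | x. in_lp p x \<and> K \<subseteq> p_hull s p x}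
     else \<infinity>)"

end

theory Submission
  imports Defs
begin

text \<open>
  Let \<open>J\<close> denote the canonical embedding and let \<open>w\<close> be a sequence in \<open>E''\<close> whose \<open>p\<close>-convex
  hull contains \<open>J K\<close>. Finitely many points \<open>J k = (\<Sum>n. \<alpha> k n w n)\<close> can be approximated arbitrarily
  well, with the same coefficients, by a finite sequence \<open>x\<close> in \<open>E\<close> with \<open>norm (x n) \<le> norm (w n)\<close> for
  all \<open>n\<close>: this is a separation argument, and the finitely many small errors cost little. For
  infinite \<open>K\<close>, round each \<open>k\<close> to one of finitely many \<open>\<rho> k \<in> K\<close> whose first \<open>N\<close> coefficients are
  nearly those of \<open>k\<close>. The differences \<open>k - \<rho> k\<close> lie in \<open>E\<close> and form a set of arbitrarily small
  \<open>p\<close>-measure in \<open>E''\<close>, so the procedure can be iterated and the finite sets summed up.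
\<close>

section \<open>The Hahn--Banach theorem\<close>

text \<open>The obstacle is that values in E'' can be pulled back to E only at finitely many points,
  while rounding can control only finitely many coefficients: the unit ball of coefficients is not
  norm compact. What rounding misses in the remaining coefficients is absorbed by the short tail of
  \<open>w\<close>. Pointwise domination of \<open>x\<close> by \<open>w\<close> is what preserves
  the constant: every \<open>lp_le\<close> bound for \<open>w\<close> passes to \<open>x\<close>,
  whatever the exponent. In the iteration only the initial stage costs about \<open>c\<close>; the
  size of each remainder can be prescribed in advance, so all later stages together cost as little
  as desired. This is why crude constants in the treatment of remainders do not spoil the equality
  of the measures. Separation needs real functionals only. The scalar field enters through the
  coefficients and through the way a real functional on E is extended to E''.\<close>

definition sublinear :: "('a::real_vector \<Rightarrow> real) \<Rightarrow> bool" where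
  "sublinear q \<longleftrightarrow> (\<forall>x y. q (x + y) \<le> q x + q y) \<and> (\<forall>t>0. \<forall>x. q (t *\<^sub>R x) \<le> t * q x)"

lemma sublinear_add: "sublinear q \<Longrightarrow> q (x + y) \<le> q x + q y"
  by (simp add: sublinear_def)

lemma sublinear_scale:
  assumes "sublinear q" and "0 < t"
  shows "q (t *\<^sub>R x) = t * q x"
proof (rule antisym)
  show "q (t *\<^sub>R x) \<le> t * q x"
    using assms by (simp add: sublinear_def)
  have "q ((1 / t) *\<^sub>R (t *\<^sub>R x)) \<le> (1 / t) * q (t *\<^sub>R x)"
    using assms unfolding sublinear_def by (metis zero_less_divide_1_iff)
  then show "t * q x \<le> q (t *\<^sub>R x)"
    using assms(2) by (simp add: field_simps)
qed

lemma sublinear_zero: "sublinear q \<Longrightarrow> q 0 = 0"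
  using sublinear_scale[of q 2 0] by simp

lemma sublinear_minus: "sublinear q \<Longrightarrow> - q (- x) \<le> q x"
  using sublinear_add[of q x "- x"] sublinear_zero[of q] by simp

text \<open>For sublinear \<open>q\<close> this is the largest sublinear functional below
  \<open>q\<close> whose value at \<open>- a\<close> is at most \<open>- q a\<close>. A linear
  functional below it therefore agrees with \<open>q\<close> at \<open>a\<close>.\<close>

definition tilt :: "('a::real_vector \<Rightarrow> real) \<Rightarrow> 'a \<Rightarrow> 'a \<Rightarrow> real" where
  "tilt q a x = (INF t\<in>{0..}. q (x + t *\<^sub>R a) - t * q a)"

lemma tilt_lower:
  assumes "sublinear q" and "0 \<le> t"
  shows "tilt q a x \<le> q (x + t *\<^sub>R a) - t * q a"
  unfolding tilt_def
proof (rule cINF_lower)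
  show "bdd_below ((\<lambda>t. q (x + t *\<^sub>R a) - t * q a) ` {0..})"
  proof (rule bdd_belowI2[of _ "- q (- x)"])
    fix t :: real assume "t \<in> {0..}"
    then have "q (t *\<^sub>R a) = t * q a"
      using sublinear_scale[OF assms(1), of t a] sublinear_zero[OF assms(1)]
      by (cases "t = 0") auto
    then show "- q (- x) \<le> q (x + t *\<^sub>R a) - t * q a"
      using sublinear_add[OF assms(1), of "x + t *\<^sub>R a" "- x"] by simp
  qed
qed (use assms in auto)

lemma tilt_greatest:
  assumes "\<And>t. 0 \<le> t \<Longrightarrow> m \<le> q (x + t *\<^sub>R a) - t * q a"
  shows "m \<le> tilt q a x"
  unfolding tilt_def by (rule cINF_greatest) (use assms in auto)

lemma sublinear_tilt:
  assumes q: "sublinear q"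
  shows "sublinear (tilt q a)"
  unfolding sublinear_def
proof safe
  fix x y
  have "tilt q a (x + y) - (q (y + t *\<^sub>R a) - t * q a) \<le> q (x + s *\<^sub>R a) - s * q a"
    if "0 \<le> s" "0 \<le> t" for s t
    using tilt_lower[OF q, of "s + t" a "x + y"] that
      sublinear_add[OF q, of "x + s *\<^sub>R a" "y + t *\<^sub>R a"]
    by (simp add: algebra_simps)
  then have "tilt q a (x + y) - (q (y + t *\<^sub>R a) - t * q a) \<le> tilt q a x" if "0 \<le> t" for t
    using that by (intro tilt_greatest)
  then have "tilt q a (x + y) - tilt q a x \<le> q (y + t *\<^sub>R a) - t * q a" if "0 \<le> t" for t
    using that by (simp add: algebra_simps)
  then have "tilt q a (x + y) - tilt q a x \<le> tilt q a y"
    by (intro tilt_greatest)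
  then show "tilt q a (x + y) \<le> tilt q a x + tilt q a y"
    by simp
next
  fix c :: real and x assume c: "0 < c"
  have "tilt q a (c *\<^sub>R x) / c \<le> q (x + t *\<^sub>R a) - t * q a" if "0 \<le> t" for t
  proof -
    have "tilt q a (c *\<^sub>R x) \<le> q (c *\<^sub>R (x + t *\<^sub>R a)) - (c * t) * q a"
      using tilt_lower[OF q, of "c * t" a "c *\<^sub>R x"] c that by (simp add: algebra_simps)
    then show ?thesis
      using c unfolding sublinear_scale[OF q c] by (simp add: field_simps)
  qed
  then have "tilt q a (c *\<^sub>R x) / c \<le> tilt q a x"
    by (rule tilt_greatest)
  then show "tilt q a (c *\<^sub>R x) \<le> c * tilt q a x"
    using c by (simp add: field_simps)
qed

lemma tilt_le: "sublinear q \<Longrightarrow> tilt q a x \<le> q x"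
  using tilt_lower[of q 0] by simp

lemma tilt_minus_le: "sublinear q \<Longrightarrow> tilt q a (- a) \<le> - q a"
  using tilt_lower[of q 1 a "- a"] sublinear_zero[of q] by simp

text \<open>Zorn's lemma for the reversed pointwise order: a nonempty chain is bounded by its
  pointwise infimum, which is finite because every member satisfies q x \<ge> - q (- x) \<ge> - p (-
  x).\<close>

lemma minimal_sublinear_exists:
  assumes p: "sublinear p"
  obtains q where "sublinear q" "\<And>x. q x \<le> p x"
    "\<And>q'. sublinear q' \<Longrightarrow> (\<And>x. q' x \<le> q x) \<Longrightarrow> q' = q"
proof -
  define A where "A = {q. sublinear q \<and> (\<forall>x. q x \<le> p x)}"
  let ?P = "\<lambda>(q :: 'a \<Rightarrow> real) q'. \<forall>x. q' x \<le> q x"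
  have "\<exists>m\<in>A. \<forall>a\<in>A. ?P m a \<longrightarrow> a = m"
  proof (rule predicate_Zorn)
    show "partial_order_on A (relation_of ?P A)"
      by (rule partial_order_on_relation_ofI) (auto simp: fun_eq_iff intro: order_trans antisym)
  next
    fix C assume C: "C \<in> Chains (relation_of ?P A)"
    have CA: "C \<subseteq> A"
      using C by (auto simp: Chains_def relation_of_def)
    show "\<exists>u\<in>A. \<forall>a\<in>C. ?P a u"
    proof (cases "C = {}")
      case True
      then show ?thesis using p by (auto simp: A_def)
    next
      case False
      have bdd: "bdd_below ((\<lambda>q. q x) ` C)" for x
      proof (rule bdd_belowI2)
        fix q assume "q \<in> C"
        then show "- p (- x) \<le> q x"
          using CA sublinear_minus[of q x] by (force simp: A_def intro: order_trans[rotated])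
      qed
      define u where "u x = (INF q\<in>C. q x)" for x
      have le: "u x \<le> q x" if "q \<in> C" for q x
        unfolding u_def using bdd that by (rule cINF_lower)
      have greatest: "m \<le> u x" if "\<And>q. q \<in> C \<Longrightarrow> m \<le> q x" for m x
        unfolding u_def using False that by (rule cINF_greatest)
      \<comment> \<open>Subadditivity of the infimum needs the chain: the smaller of
        \<open>q\<close> and \<open>q'\<close> serves for both arguments.\<close>
      have sub: "u (x + y) \<le> q x + q' y" if qs: "q \<in> C" "q' \<in> C" for x y q q'
      proof -
        have "?P q q' \<or> ?P q' q"
          using C that by (auto simp: Chains_def relation_of_def)
        then obtain r where r: "r \<in> C" "r x \<le> q x" "r y \<le> q' y"
          using qs by blast
        then have "r (x + y) \<le> r x + r y"
          using CA by (intro sublinear_add) (auto simp: A_def)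
        then show ?thesis
          using r le[of r "x + y"] by linarith
      qed
      have "sublinear u"
        unfolding sublinear_def
      proof safe
        fix x y
        have "u (x + y) - q' y \<le> u x" if "q' \<in> C" for q'
          using sub that by (intro greatest) (simp add: algebra_simps)
        then have "u (x + y) - u x \<le> u y"
          by (intro greatest) (simp add: algebra_simps)
        then show "u (x + y) \<le> u x + u y"
          by simp
      next
        fix t :: real and x assume t: "0 < t"
        have "u (t *\<^sub>R x) / t \<le> u x"
        proof (rule greatest)
          fix q assume q: "q \<in> C"
          then have "q (t *\<^sub>R x) = t * q x"
            using CA t by (intro sublinear_scale) (auto simp: A_def)
          then show "u (t *\<^sub>R x) / t \<le> q x"
            using le[OF q, of "t *\<^sub>R x"] t by (simp add: field_simps)
        qed
        then show "u (t *\<^sub>R x) \<le> t * u x"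
          using t by (simp add: field_simps)
      qed
      moreover have "u x \<le> p x" for x
      proof -
        obtain q where "q \<in> C" using False by blast
        then have "q x \<le> p x" using CA by (auto simp: A_def)
        then show ?thesis using le[OF \<open>q \<in> C\<close>, of x] by linarith
      qed
      ultimately show ?thesis
        using le by (auto simp: A_def)
    qed
  qed
  then obtain m where m: "m \<in> A" "\<And>a. a \<in> A \<Longrightarrow> ?P m a \<Longrightarrow> a = m"
    by blast
  show thesis
  proof (rule that[of m])
    fix q' assume "sublinear q'" "\<And>x. q' x \<le> m x"
    then show "q' = m"
      using m by (intro m(2)) (auto simp: A_def intro: order_trans)
  qed (use m(1) in \<open>auto simp: A_def\<close>)
qed

text \<open>A minimal sublinear functional coincides with all its tilts, which makes it odd.\<close>

theorem Hahn_Banach_sublinear: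
  fixes p :: "'a::real_vector \<Rightarrow> real"
  assumes p: "sublinear p"
  obtains f where "linear f" "\<And>x. f x \<le> p x" "f a = p a"
proof -
  \<comment> \<open>Minimising below \<open>tilt p a\<close> instead of \<open>p\<close> forces f (-
    a) \<le> - p a; oddness then turns this into attainment at \<open>a\<close>.\<close>
  obtain f where f: "sublinear f" "\<And>x. f x \<le> tilt p a x"
      and min: "\<And>q. sublinear q \<Longrightarrow> (\<And>x. q x \<le> f x) \<Longrightarrow> q = f"
    using minimal_sublinear_exists[OF sublinear_tilt[OF p, of a]] by metis
  have odd: "f (- x) = - f x" for x
  proof -
    have "tilt f x = f"
      using f(1) by (intro min sublinear_tilt tilt_le)
    then show ?thesis
      using tilt_minus_le[OF f(1), of x] sublinear_minus[OF f(1), of "- x"] by simp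
  qed
  have le_p: "f x \<le> p x" for x
    using f(2)[of x] tilt_le[OF p, of a x] by linarith
  show thesis
  proof (rule that[OF _ le_p])
    have add: "f (x + y) = f x + f y" for x y
      using sublinear_add[OF f(1), of x y] sublinear_add[OF f(1), of "- x" "- y"]
        odd[of "x + y"] odd[of x] odd[of y] by simp
    show "linear f"
    proof (rule linearI[OF add])
      fix r :: real and x
      consider "0 < r" | "r = 0" | "0 < - r" by linarith
      then show "f (r *\<^sub>R x) = r *\<^sub>R f x"
      proof cases
        case 3
        then show ?thesis
          using sublinear_scale[OF f(1) 3, of x] odd[of "r *\<^sub>R x"] by simp
      qed (use sublinear_scale[OF f(1)] sublinear_zero[OF f(1)] in auto)
    qed
    have "- f a \<le> - p a"
      using f(2)[of "- a"] tilt_minus_le[OF p, of a] odd[of a] by simp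
    then show "f a = p a"
      using le_p[of a] by simp
  qed
qed

lemma bounded_linear_le_norm:
  fixes f :: "'a::real_normed_vector \<Rightarrow> real"
  assumes "linear f" and "\<And>x. f x \<le> c * norm x"
  shows "bounded_linear f"
proof (rule bounded_linear_intro)
  show "norm (f x) \<le> norm x * c" for x
    using assms(2)[of x] assms(2)[of "- x"] linear_neg[OF assms(1), of x]
    by (simp add: mult.commute)
qed (use assms(1) in \<open>simp_all add: linear_add linear_scale\<close>)

section \<open>Norming and separating functionals\<close>

lemma norming_functional:
  fixes x :: "'a::real_normed_vector"
  obtains f :: "'a \<Rightarrow>\<^sub>L real" where "norm f \<le> 1" "blinfun_apply f x = norm x"
proof -
  have "sublinear (norm :: 'a \<Rightarrow> real)"
    by (auto simp: sublinear_def norm_triangle_ineq)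
  then obtain f where f: "linear f" "\<And>y. f y \<le> norm y" "f x = norm x"
    by (rule Hahn_Banach_sublinear[where a = x]) blast
  have bl: "bounded_linear f"
    by (rule bounded_linear_le_norm[of _ 1]) (use f in auto)
  show thesis
  proof (rule that[of "Blinfun f"])
    show "norm (Blinfun f) \<le> 1"
    proof (rule norm_blinfun_bound)
      show "norm (blinfun_apply (Blinfun f) y) \<le> 1 * norm y" for y
        using f(2)[of y] f(2)[of "- y"] linear_neg[OF f(1), of y]
        by (simp add: bounded_linear_Blinfun_apply[OF bl])
    qed simp
  qed (simp add: bounded_linear_Blinfun_apply[OF bl] f(3))
qed

text \<open>Hahn--Banach is applied to the Minkowski functional \<open>g\<close> of the open
  \<open>r\<close>-neighbourhood \<open>U\<close> of \<open>C\<close>. It is finite since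
  \<open>U\<close> contains the ball of radius \<open>r\<close>, and at least 1 at \<open>k\<close>
  since \<open>k\<close> is not in \<open>U\<close>. The quantitative gap \<open>r * norm f\<close>
  comes from testing \<open>f\<close> on the whole ball around each point of
  \<open>C\<close>.\<close>

lemma separate_point_from_convex:
  fixes C :: "'a::real_normed_vector set"
  assumes C: "convex C" "0 \<in> C" and r: "0 < r" and far: "\<And>c. c \<in> C \<Longrightarrow> r \<le> dist k c"
  obtains f :: "'a \<Rightarrow>\<^sub>L real" where
    "f \<noteq> 0" "\<And>c. c \<in> C \<Longrightarrow> blinfun_apply f c + r * norm f \<le> blinfun_apply f k"
proof -
  define U where "U = {c + b | c b. c \<in> C \<and> norm b < r}"
  have UI: "c + b \<in> U" if "c \<in> C" "norm b < r" for c b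
    unfolding U_def using that by (intro CollectI exI[of _ c] exI[of _ b]) simp
  have cU: "convex U"
  proof -
    have "U = (\<Union>c\<in>C. \<Union>b\<in>ball 0 r. {c + b})"
      using UI by (auto simp: U_def)
    then show ?thesis
      using convex_sums[OF C(1) convex_ball[of 0 r]] by simp
  qed
  have kU: "k \<notin> U"
    using far by (auto simp: U_def dist_norm) (metis add_diff_cancel_left' linorder_not_less)
  have small: "x \<in> U" if "norm x < r" for x
    using UI[OF C(2) that] by simp
  define S where "S x = {t. 0 < t \<and> (1 / t) *\<^sub>R x \<in> U}" for x
  define g where "g x = Inf (S x)" for x
  have S_small: "t \<in> S x" if "norm x < t * r" for t x
  proof -
    have "0 < t"
      using that r by (smt (verit) norm_ge_zero zero_less_mult_pos2)
    then show ?thesis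
      using that small[of "(1 / t) *\<^sub>R x"] by (simp add: S_def field_simps)
  qed
  have ne: "S x \<noteq> {}" for x
    using S_small[of x "norm x / r + 1"] r by (auto simp: field_simps)
  have lower: "g x \<le> t" if "t \<in> S x" for x t
    unfolding g_def by (rule cInf_lower[OF that]) (auto simp: S_def intro!: bdd_belowI[of _ 0])
  have greatest: "m \<le> g x" if "\<And>t. t \<in> S x \<Longrightarrow> m \<le> t" for m x
    unfolding g_def using ne that by (rule cInf_greatest)
  have S_add: "s + t \<in> S (x + y)" if "s \<in> S x" "t \<in> S y" for s t x y
  proof -
    have "(s / (s + t)) *\<^sub>R ((1 / s) *\<^sub>R x) + (t / (s + t)) *\<^sub>R ((1 / t) *\<^sub>R y) \<in> U"
      using that by (intro convexD[OF cU]) (auto simp: S_def simp flip: add_divide_distrib)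
    then show ?thesis
      using that by (simp add: S_def scaleR_add_right)
  qed
  have S_scale: "c * t \<in> S (c *\<^sub>R x)" if "t \<in> S x" "0 < c" for c t x
    using that by (simp add: S_def)
  have "sublinear g"
    unfolding sublinear_def
  proof safe
    fix x y
    have "g (x + y) - t \<le> s" if "s \<in> S x" "t \<in> S y" for s t
      using lower[OF S_add[OF that]] by simp
    then have "g (x + y) - t \<le> g x" if "t \<in> S y" for t
      using that by (intro greatest)
    then have "g (x + y) - g x \<le> t" if "t \<in> S y" for t
      using that by (simp add: algebra_simps)
    then have "g (x + y) - g x \<le> g y"
      by (intro greatest)
    then show "g (x + y) \<le> g x + g y" by simp
  next
    fix c :: real and x assume c: "0 < c"
    have "g (c *\<^sub>R x) / c \<le> g x"
    proof (rule greatest)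
      fix t assume "t \<in> S x"
      then show "g (c *\<^sub>R x) / c \<le> t"
        using lower[OF S_scale[of t x c]] c by (simp add: field_simps)
    qed
    then show "g (c *\<^sub>R x) \<le> c * g x"
      using c by (simp add: field_simps)
  qed
  then obtain f where f: "linear f" "\<And>x. f x \<le> g x" "f k = g k"
    by (rule Hahn_Banach_sublinear[where a = k]) blast
  have fU: "f x \<le> 1" if "x \<in> U" for x
    using f(2)[of x] lower[of 1 x] that by (simp add: S_def)
  have fk: "1 \<le> f k"
    unfolding f(3)
  proof (rule greatest, rule ccontr)
    fix t assume t: "t \<in> S k" "\<not> 1 \<le> t"
    \<comment> \<open>The point \<open>k\<close> lies on the segment from 0 to
      \<open>(1 / t) *\<^sub>R k\<close>, so convexity would put it into \<open>U\<close>.\<close>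
    then have "t *\<^sub>R ((1 / t) *\<^sub>R k) + (1 - t) *\<^sub>R 0 \<in> U"
      using small[of 0] r by (intro convexD[OF cU]) (auto simp: S_def)
    then show False
      using t kU by (simp add: S_def)
  qed
  have "f x \<le> (1 / r) * norm x" for x
  proof (rule order_trans[OF f(2)], rule field_le_epsilon)
    fix e :: real assume "0 < e"
    then show "g x \<le> (1 / r) * norm x + e"
      using r by (intro lower S_small) (simp add: field_simps)
  qed
  then have bl: "bounded_linear f"
    by (rule bounded_linear_le_norm[OF f(1)])
  show thesis
  proof (rule that[of "Blinfun f"])
    show "Blinfun f \<noteq> 0"
      using fk bounded_linear_Blinfun_apply[OF bl] by (metis blinfun.zero_left not_one_le_zero)
    fix c assume c: "c \<in> C"
    have "norm (Blinfun f) \<le> (f k - f c) / r"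
    proof (rule norm_blinfun_bound)
      have *: "f b \<le> (f k - f c) / r * norm b" for b
      proof (cases "b = 0")
        case False
        \<comment> \<open>\<open>U\<close> is built from an open ball, so the estimate is available
          only for radii s < r; the case s = r follows by a limit.\<close>
        have "s * f b \<le> (f k - f c) * norm b" if s: "0 < s" "s < r" for s
        proof -
          have "f (c + (s / norm b) *\<^sub>R b) \<le> 1"
            using False s by (intro fU UI c) auto
          then have "f c + s / norm b * f b \<le> f k"
            using fk by (simp add: linear_add[OF f(1)] linear_scale[OF f(1)])
          then show ?thesis
            using False by (simp add: field_simps)
        qed
        moreover have "((\<lambda>s. s * f b) \<longlongrightarrow> r * f b) (at_left r)"
          by (intro tendsto_intros)
        moreover have "\<forall>\<^sub>F s in at_left r. s \<in> {0<..<r}"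
          using r by (intro eventually_at_leftI[of 0]) auto
        ultimately have "r * f b \<le> (f k - f c) * norm b"
          by (intro tendsto_upperbound[of "\<lambda>s. s * f b"]) (auto elim!: eventually_mono)
        then show ?thesis
          using r by (simp add: field_simps)
      qed (simp add: linear_0[OF f(1)])
      show "norm (blinfun_apply (Blinfun f) b) \<le> (f k - f c) / r * norm b" for b
        using *[of b] *[of "- b"] linear_neg[OF f(1), of b]
        by (simp add: bounded_linear_Blinfun_apply[OF bl] abs_le_iff)
      show "0 \<le> (f k - f c) / r"
        using fk fU[of c] UI[OF c, of 0] r by simp
    qed
    then show "blinfun_apply (Blinfun f) c + r * norm (Blinfun f) \<le> blinfun_apply (Blinfun f) k"
      using r by (simp add: bounded_linear_Blinfun_apply[OF bl] field_simps)
  qed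
qed

section \<open>Sequence spaces\<close>

text \<open>Each power splits as a * a^(r-1), and the second factor is at most S^(r-1) for the total
  S. This comparison of the r-norm with the 1-norm replaces Minkowski's inequality wherever several
  sequences are combined.\<close>

lemma sum_powr_le_powr_sum:
  fixes a :: "'i \<Rightarrow> real"
  assumes "1 \<le> r" and a: "\<And>i. i \<in> A \<Longrightarrow> 0 \<le> a i" and "finite A"
  shows "(\<Sum>i\<in>A. a i powr r) \<le> (\<Sum>i\<in>A. a i) powr r"
proof -
  let ?S = "\<Sum>i\<in>A. a i"
  have S: "0 \<le> ?S"
    by (rule sum_nonneg) (rule a)
  have split: "b powr r = b * b powr (r - 1)" if "0 \<le> b" for b :: real
    using that by (cases "b = 0") (simp_all add: powr_diff)
  have "(\<Sum>i\<in>A. a i powr r) \<le> (\<Sum>i\<in>A. a i * ?S powr (r - 1))"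
  proof (rule sum_mono)
    fix i assume i: "i \<in> A"
    then have "a i \<le> ?S"
      by (intro member_le_sum) (use assms in auto)
    then show "a i powr r \<le> a i * ?S powr (r - 1)"
      unfolding split[OF a[OF i]] using a[OF i] assms(1) by (intro mult_left_mono powr_mono2) auto
  qed
  also have "\<dots> = ?S powr r"
    using split[OF S] by (simp flip: sum_distrib_right)
  finally show ?thesis .
qed

text \<open>Membership is bundled with the bound because the value of \<open>lp_norm\<close> alone
  may carry no information for a divergent series or an unbounded sequence.\<close>

definition lp_le :: "ennreal \<Rightarrow> real \<Rightarrow> (nat \<Rightarrow> 'a::real_normed_vector) \<Rightarrow> bool" where
  "lp_le p c x \<longleftrightarrow> in_lp p x \<and> lp_norm p x \<le> c"

lemma enn2real_ge_1: "1 \<le> p \<Longrightarrow> p \<noteq> \<infinity> \<Longrightarrow> 1 \<le> enn2real p"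
  by (cases p) auto

lemma lp_le_infinity_iff: "lp_le top c x \<longleftrightarrow> x \<longlonglongrightarrow> 0 \<and> (\<forall>n. norm (x n) \<le> c)"
proof -
  have "(SUP n. norm (x n)) \<le> c \<longleftrightarrow> (\<forall>n. norm (x n) \<le> c)" if "x \<longlonglongrightarrow> 0"
  proof -
    have "Bseq x"
      using that by (metis convergentI convergent_imp_Bseq)
    then have "bdd_above (range (\<lambda>n. norm (x n)))"
      by (auto simp: Bseq_def intro: bdd_aboveI2)
    then show ?thesis
      by (simp add: cSUP_le_iff)
  qed
  then show ?thesis
    by (auto simp: lp_le_def in_lp_def lp_norm_def)
qed

text \<open>Passing to partial sums turns estimates for finite exponents into estimates of finite
  sums and yields summability along with the bound.\<close>

lemma lp_le_finite_iff:
  assumes "1 \<le> p" "p \<noteq> \<infinity>" "0 \<le> c"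
  shows "lp_le p c x \<longleftrightarrow> (\<forall>n. (\<Sum>i<n. norm (x i) powr enn2real p) \<le> c powr enn2real p)"
    (is "_ \<longleftrightarrow> ?R")
proof -
  let ?r = "enn2real p"
  have r: "1 \<le> ?r"
    using assms by (intro enn2real_ge_1)
  show ?thesis
  proof
    assume "lp_le p c x"
    then have s: "summable (\<lambda>n. norm (x n) powr ?r)"
      and le: "(\<Sum>n. norm (x n) powr ?r) powr (1 / ?r) \<le> c"
      using assms by (auto simp: lp_le_def in_lp_def lp_norm_def)
    have "((\<Sum>n. norm (x n) powr ?r) powr (1 / ?r)) powr ?r \<le> c powr ?r"
      using le r by (intro powr_mono2) auto
    then have "(\<Sum>n. norm (x n) powr ?r) \<le> c powr ?r"
      using r suminf_nonneg[OF s] by (simp add: powr_powr)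
    then show ?R
      using sum_le_suminf[OF s] by (meson finite_lessThan order_trans powr_ge_zero)
  next
    assume R: ?R
    have s: "summable (\<lambda>n. norm (x n) powr ?r)"
      using R by (intro summableI_nonneg_bounded[of _ "c powr ?r"]) auto
    have "(\<Sum>n. norm (x n) powr ?r) powr (1 / ?r) \<le> (c powr ?r) powr (1 / ?r)"
      using r R suminf_nonneg[OF s] by (intro powr_mono2 suminf_le_const[OF s]) auto
    then show "lp_le p c x"
      using assms r s by (simp add: lp_le_def in_lp_def lp_norm_def powr_powr)
  qed
qed

lemma lp_le_nonneg: "lp_le p c x \<Longrightarrow> 0 \<le> c"
proof -
  assume l: "lp_le p c x"
  show "0 \<le> c"
  proof (cases "p = \<infinity>")
    case True
    then have "norm (x 0) \<le> c"
      using l by (simp add: lp_le_infinity_iff)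
    then show ?thesis
      by (rule order_trans[OF norm_ge_zero])
  next
    case False
    then show ?thesis
      using l by (auto simp: lp_le_def lp_norm_def intro: order_trans[OF powr_ge_zero])
  qed
qed

lemma lp_le_weaken: "lp_le p c x \<Longrightarrow> c \<le> d \<Longrightarrow> lp_le p d x"
  by (auto simp: lp_le_def)

lemma lp_le_scale:
  assumes p: "1 \<le> p" and y: "lp_le p c y" and t: "0 \<le> t"
    and le: "\<And>n. norm (x n) \<le> t * norm (y n)"
  shows "lp_le p (t * c) x"
proof (cases "p = \<infinity>")
  case True
  have "(\<lambda>n. t * norm (y n)) \<longlonglongrightarrow> 0"
    using y True by (intro tendsto_mult_right_zero tendsto_norm_zero) (simp add: lp_le_infinity_iff)
  then have "x \<longlonglongrightarrow> 0"
    by (rule Lim_null_comparison[rotated]) (simp add: le)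
  moreover have "norm (x n) \<le> t * c" for n
    using le[of n] y True t by (auto simp: lp_le_infinity_iff intro: order_trans mult_left_mono)
  ultimately show ?thesis
    using True by (simp add: lp_le_infinity_iff)
next
  case False
  let ?r = "enn2real p"
  have r: "1 \<le> ?r"
    using p False by (rule enn2real_ge_1)
  note c = lp_le_nonneg[OF y]
  have "(\<Sum>i<n. norm (x i) powr ?r) \<le> (t * c) powr ?r" for n
  proof -
    have "(\<Sum>i<n. norm (x i) powr ?r) \<le> (\<Sum>i<n. t powr ?r * norm (y i) powr ?r)"
    proof (rule sum_mono)
      fix i
      have "norm (x i) powr ?r \<le> (t * norm (y i)) powr ?r"
        using r le by (intro powr_mono2) auto
      then show "norm (x i) powr ?r \<le> t powr ?r * norm (y i) powr ?r"
        using t by (simp add: powr_mult)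
    qed
    also have "\<dots> \<le> t powr ?r * c powr ?r"
      unfolding sum_distrib_left[symmetric]
      using y p False c by (intro mult_left_mono) (simp_all add: lp_le_finite_iff)
    finally show ?thesis
      using t c by (simp add: powr_mult)
  qed
  then show ?thesis
    using p False t c by (simp add: lp_le_finite_iff)
qed

lemma lp_le_mono:
  assumes "1 \<le> p" "lp_le p c y" "\<And>n. norm (x n) \<le> norm (y n)"
  shows "lp_le p c x"
  using lp_le_scale[of p c y 1 x] assms by simp

text \<open>The factor 2 is an artefact of avoiding Minkowski's inequality.\<close>

lemma lp_le_add:
  assumes p: "1 \<le> p" and y: "lp_le p a y" and z: "lp_le p b z"
    and le: "\<And>n. norm (x n) \<le> norm (y n) + norm (z n)"
  shows "lp_le p (2 * (a + b)) x"
proof (cases "p = \<infinity>")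
  case True
  have "(\<lambda>n. norm (y n) + norm (z n)) \<longlonglongrightarrow> 0"
    using y z True by (intro tendsto_add_zero tendsto_norm_zero) (simp_all add: lp_le_infinity_iff)
  then have "x \<longlonglongrightarrow> 0"
    by (rule Lim_null_comparison[rotated]) (simp add: le)
  moreover have "norm (x n) \<le> 2 * (a + b)" for n
    using y z True le[of n] lp_le_nonneg[OF y] lp_le_nonneg[OF z]
    by (force simp: lp_le_infinity_iff dest!: spec[of _ n])
  ultimately show ?thesis
    using True by (simp add: lp_le_infinity_iff)
next
  case False
  let ?r = "enn2real p"
  have r: "1 \<le> ?r"
    using p False by (rule enn2real_ge_1)
  note a = lp_le_nonneg[OF y] and b = lp_le_nonneg[OF z]
  have "(\<Sum>i<n. norm (x i) powr ?r) \<le> (2 * (a + b)) powr ?r" for n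
  proof -
    have "(\<Sum>i<n. norm (x i) powr ?r)
        \<le> (\<Sum>i<n. 2 powr ?r * (norm (y i) powr ?r + norm (z i) powr ?r))"
    proof (rule sum_mono)
      fix i
      have "norm (x i) powr ?r \<le> (2 * max (norm (y i)) (norm (z i))) powr ?r"
        using r le[of i] by (intro powr_mono2) auto
      also have "\<dots> = 2 powr ?r * max (norm (y i)) (norm (z i)) powr ?r"
        by (simp add: powr_mult)
      also have "\<dots> \<le> 2 powr ?r * (norm (y i) powr ?r + norm (z i) powr ?r)"
        by (auto simp: max_def)
      finally show "norm (x i) powr ?r \<le> \<dots>" .
    qed
    also have "\<dots> \<le> 2 powr ?r * (a powr ?r + b powr ?r)"
      unfolding sum_distrib_left[symmetric] sum.distrib using y z p False a b
      by (intro mult_left_mono add_mono) (simp_all add: lp_le_finite_iff)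
    also have "\<dots> \<le> 2 powr ?r * (a + b) powr ?r"
      using sum_powr_le_powr_sum[of ?r "UNIV :: bool set" "\<lambda>i. if i then a else b"] r a b
      by (intro mult_left_mono) (auto simp: UNIV_bool add.commute)
    also have "\<dots> = (2 * (a + b)) powr ?r"
      using a b by (subst powr_mult) auto
    finally show ?thesis .
  qed
  then show ?thesis
    using p False a b by (simp add: lp_le_finite_iff)
qed

lemma lp_le_finite_support:
  assumes p: "1 \<le> p" and zero: "\<And>n. N \<le> n \<Longrightarrow> x n = 0"
  shows "lp_le p (\<Sum>n<N. norm (x n)) x"
proof (cases "p = \<infinity>")
  case True
  have "x \<longlonglongrightarrow> 0"
    by (rule tendsto_eventually) (use zero in \<open>auto simp: eventually_sequentially\<close>)
  moreover have "norm (x n) \<le> (\<Sum>n<N. norm (x n))" for n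
  proof (cases "n < N")
    case True
    then show ?thesis by (intro member_le_sum) auto
  qed (use zero in \<open>simp add: sum_nonneg\<close>)
  ultimately show ?thesis
    using True by (simp add: lp_le_infinity_iff)
next
  case False
  let ?r = "enn2real p"
  have r: "1 \<le> ?r"
    using p False by (rule enn2real_ge_1)
  have "(\<Sum>i<n. norm (x i) powr ?r) \<le> (\<Sum>n<N. norm (x n)) powr ?r" for n
  proof -
    have "(\<Sum>i<n. norm (x i)) \<le> (\<Sum>i<n + N. norm (x i))"
      by (intro sum_mono2) auto
    also have "\<dots> = (\<Sum>i<N. norm (x i))"
      using zero by (intro sum.mono_neutral_right) auto
    finally have "(\<Sum>i<n. norm (x i)) powr ?r \<le> (\<Sum>n<N. norm (x n)) powr ?r"
      using r by (intro powr_mono2) (auto simp: sum_nonneg)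
    moreover have "(\<Sum>i<n. norm (x i) powr ?r) \<le> (\<Sum>i<n. norm (x i)) powr ?r"
      using r by (intro sum_powr_le_powr_sum) auto
    ultimately show ?thesis by linarith
  qed
  then show ?thesis
    using p False by (simp add: lp_le_finite_iff sum_nonneg)
qed

text \<open>Merges countably many sequences into one. The same statement serves the vectors and the
  coefficients of an infinite sum of hulls, since the crude total \<open>suminf c\<close> is valid
  for every exponent.\<close>

lemma lp_le_rows:
  assumes p: "1 \<le> p" and x: "\<And>j. lp_le p (c j) (x j)" and c: "summable c"
  shows "lp_le p (suminf c) (\<lambda>i. case prod_decode i of (j, n) \<Rightarrow> x j n)"
proof -
  let ?z = "\<lambda>i. case prod_decode i of (j, n) \<Rightarrow> x j n"
  note c0 = lp_le_nonneg[OF x]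
  have S0: "0 \<le> suminf c"
    using c c0 by (rule suminf_nonneg)
  \<comment> \<open>An initial segment of the enumeration sits inside a finite square, where sums
    can be taken row by row.\<close>
  have box: "\<exists>M. prod_decode ` {..<n} \<subseteq> {..<M} \<times> {..<M}" for n
  proof -
    have "finite (fst ` prod_decode ` {..<n} \<union> snd ` prod_decode ` {..<n})" by blast
    then obtain M where M: "\<And>i. i \<in> fst ` prod_decode ` {..<n} \<union> snd ` prod_decode ` {..<n} \<Longrightarrow> i < M"
      by (metis finite_nat_bounded lessThan_iff subsetD)
    have "prod_decode ` {..<n} \<subseteq> {..<M} \<times> {..<M}"
    proof
      fix u assume u: "u \<in> prod_decode ` {..<n}"
      then have "fst u < M" "snd u < M" by (auto intro!: M)
      then show "u \<in> {..<M} \<times> {..<M}" by (cases u) auto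
    qed
    then show ?thesis ..
  qed
  show ?thesis
  proof (cases "p = \<infinity>")
    case True
    have rows: "x j \<longlonglongrightarrow> 0" "norm (x j n) \<le> c j" for j n
      using x[of j] True by (auto simp: lp_le_infinity_iff)
    have "?z \<longlonglongrightarrow> 0"
    proof (rule LIMSEQ_I)
      fix e :: real assume e: "0 < e"
      obtain J where J: "\<And>j. J \<le> j \<Longrightarrow> c j < e"
        using LIMSEQ_D[OF summable_LIMSEQ_zero[OF c] e] c0 by auto
      have "\<exists>N. \<forall>n\<ge>N. norm (x j n) < e" for j
        using LIMSEQ_D[OF rows(1) e] by auto
      then obtain N where N: "\<And>j n. N j \<le> n \<Longrightarrow> norm (x j n) < e" by metis
      \<comment> \<open>Only indices in \<open>?B\<close> can carry a term of norm at least
        \<open>e\<close>: rows from \<open>J\<close> on are uniformly small, and each earlier row is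
        a null sequence.\<close>
      let ?B = "(\<lambda>(j, n). prod_encode (j, n)) ` (SIGMA j:{..<J}. {..<N j})"
      have "finite ?B" by blast
      then obtain M where M: "\<And>i. i \<in> ?B \<Longrightarrow> i < M"
        by (metis finite_nat_bounded lessThan_iff subsetD)
      have "norm (?z i) < e" if "M \<le> i" for i
      proof -
        obtain j n where jn: "prod_decode i = (j, n)" by force
        then have i: "i = prod_encode (j, n)" by (metis prod_decode_inverse)
        have "i \<notin> ?B" using M that by force
        then have "J \<le> j \<or> N j \<le> n"
          unfolding i by (force simp: not_less)
        then show ?thesis
          using J[of j] N[of j n] rows(2)[of j n] by (auto simp: jn)
      qed
      then show "\<exists>M. \<forall>i\<ge>M. norm (?z i - 0) < e" by auto
    qed
    moreover have "norm (?z i) \<le> suminf c" for i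
    proof -
      obtain j n where jn: "prod_decode i = (j, n)" by force
      have "c j \<le> suminf c"
        using sum_le_suminf[OF c, of "{j}"] c0 by simp
      then show ?thesis
        using rows(2)[of j n] by (simp add: jn)
    qed
    ultimately show ?thesis
      using True by (simp add: lp_le_infinity_iff)
  next
    case False
    let ?r = "enn2real p"
    have r: "1 \<le> ?r"
      using p False by (rule enn2real_ge_1)
    have "(\<Sum>i<n. norm (?z i) powr ?r) \<le> suminf c powr ?r" for n
    proof -
      obtain M where M: "prod_decode ` {..<n} \<subseteq> {..<M} \<times> {..<M}" using box by blast
      have "(\<Sum>i<n. norm (?z i) powr ?r)
          = (\<Sum>(j, m)\<in>prod_decode ` {..<n}. norm (x j m) powr ?r)"
        by (subst sum.reindex) (auto simp: inj_prod_decode case_prod_unfold)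
      also have "\<dots> \<le> (\<Sum>(j, m)\<in>{..<M} \<times> {..<M}. norm (x j m) powr ?r)"
        using M by (intro sum_mono2) auto
      also have "\<dots> = (\<Sum>j<M. \<Sum>m<M. norm (x j m) powr ?r)"
        by (simp add: sum.cartesian_product)
      also have "\<dots> \<le> (\<Sum>j<M. c j powr ?r)"
        using x p False c0 by (intro sum_mono) (simp add: lp_le_finite_iff)
      also have "\<dots> \<le> (\<Sum>j<M. c j) powr ?r"
        using r c0 by (intro sum_powr_le_powr_sum) auto
      also have "\<dots> \<le> suminf c powr ?r"
        using r c c0 by (intro powr_mono2 sum_le_suminf) (auto simp: sum_nonneg)
      finally show ?thesis .
    qed
    then show ?thesis
      using p False S0 by (simp add: lp_le_finite_iff)
  qed
qed

text \<open>For p = \<infinity> this is exactly where null sequences, as opposed to bounded ones,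
  matter.\<close>

lemma lp_le_tail:
  assumes p: "1 \<le> p" and x: "in_lp p x" and e: "0 < e"
  obtains N where "lp_le p e (\<lambda>n. if n < N then 0 else x n)"
proof (cases "p = \<infinity>")
  case True
  then have x: "x \<longlonglongrightarrow> 0" using x by (simp add: in_lp_def)
  then obtain N where N: "\<And>n. N \<le> n \<Longrightarrow> norm (x n) < e"
    using LIMSEQ_D[OF x e] by auto
  have "(\<lambda>n. if n < N then 0 else x n) \<longlonglongrightarrow> 0"
    by (rule Lim_null_comparison[OF _ tendsto_norm_zero[OF x]]) simp
  then show thesis
    using N e True by (intro that[of N]) (auto simp: lp_le_infinity_iff less_imp_le)
next
  case False
  let ?r = "enn2real p"
  have r: "1 \<le> ?r"
    using p False by (rule enn2real_ge_1)
  have s: "summable (\<lambda>n. norm (x n) powr ?r)"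
    using x False by (simp add: in_lp_def)
  obtain N where N: "norm (\<Sum>i. norm (x (i + N)) powr ?r) < e powr ?r"
    using suminf_exist_split[OF _ s, of "e powr ?r"] e by auto
  have "(\<Sum>i<n. norm (if i < N then 0 else x i) powr ?r) \<le> e powr ?r" for n
  proof -
    have "(\<Sum>i<n. norm (if i < N then 0 else x i) powr ?r)
        = (\<Sum>i\<in>{N..<n}. norm (x i) powr ?r)"
      using r by (intro sum.mono_neutral_cong_right) auto
    also have "\<dots> \<le> (\<Sum>i\<in>{0 + N..<n + N}. norm (x i) powr ?r)"
      by (intro sum_mono2) auto
    also have "\<dots> = (\<Sum>i<n. norm (x (i + N)) powr ?r)"
      by (simp only: sum.shift_bounds_nat_ivl lessThan_atLeast0)
    also have "\<dots> \<le> (\<Sum>i. norm (x (i + N)) powr ?r)"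
      using summable_ignore_initial_segment[OF s] by (intro sum_le_suminf) auto
    finally show ?thesis using N by auto
  qed
  then show thesis
    using p False e by (intro that[of N]) (simp add: lp_le_finite_iff)
qed

lemma lp_le_coord:
  assumes "1 \<le> p" "lp_le p c x"
  shows "norm (x n) \<le> c"
proof (cases "p = \<infinity>")
  case False
  let ?r = "enn2real p"
  have r: "1 \<le> ?r"
    using assms(1) False by (rule enn2real_ge_1)
  note c = lp_le_nonneg[OF assms(2)]
  have "norm (x n) powr ?r \<le> (\<Sum>i<Suc n. norm (x i) powr ?r)"
    by (intro member_le_sum) auto
  also have "\<dots> \<le> c powr ?r"
    using assms False c by (simp add: lp_le_finite_iff del: sum.lessThan_Suc)
  finally show ?thesis
    using r c by (smt (verit) norm_ge_zero powr_less_mono2)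
qed (use assms in \<open>simp add: lp_le_infinity_iff\<close>)

section \<open>Conjugate exponents and Hoelder's inequality\<close>

lemma conj_exponent_cases:
  assumes "1 \<le> p"
  obtains "p = 1" "conj_exponent p = \<infinity>" | "p = \<infinity>" "conj_exponent p = 1"
  | "p \<noteq> \<infinity>" "conj_exponent p \<noteq> \<infinity>" "1 < enn2real p" "1 < enn2real (conj_exponent p)"
    "1 / enn2real p + 1 / enn2real (conj_exponent p) = 1"
proof (cases p)
  case (real r)
  show thesis
  proof (cases "r = 1")
    case True
    then show thesis using that(1) real conj_exponent_1 by simp
  next
    case False
    then have r: "1 < r" using assms real by simp
    then have "1 - inverse p = ennreal (1 - 1 / r)"
      using real by (simp add: inverse_ennreal ennreal_minus inverse_eq_divide flip: ennreal_1)
    moreover have "0 < 1 - 1 / r" using r by simp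
    ultimately have q: "conj_exponent p = ennreal (r / (r - 1))"
      using r by (simp add: conj_exponent_def inverse_ennreal divide_simps)
    show thesis
      using r real q by (intro that(3)) (auto simp: field_simps)
  qed
next
  case top
  then show thesis using that(2) conj_exponent_infinity by simp
qed

lemma conj_exponent_ge_1: "1 \<le> p \<Longrightarrow> 1 \<le> conj_exponent p"
  by (erule conj_exponent_cases, simp_all) (cases "conj_exponent p"; simp)

lemma lp_le_Holder:
  fixes x :: "nat \<Rightarrow> 'a::real_normed_vector" and \<alpha> :: "nat \<Rightarrow> 'k::real_normed_vector"
  assumes p: "1 \<le> p" and x: "lp_le p c x" and \<alpha>: "lp_le (conj_exponent p) d \<alpha>"
  shows "summable (\<lambda>n. norm (\<alpha> n) * norm (x n))"
    and "(\<Sum>n. norm (\<alpha> n) * norm (x n)) \<le> d * c"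
proof -
  note c = lp_le_nonneg[OF x] and d = lp_le_nonneg[OF \<alpha>]
  have bound: "(\<Sum>i<n. norm (\<alpha> i) * norm (x i)) \<le> d * c" for n
    using p
  proof (cases rule: conj_exponent_cases)
    case 1
    then have "(\<Sum>i<n. norm (\<alpha> i) * norm (x i)) \<le> (\<Sum>i<n. d * norm (x i))"
      using \<alpha> by (intro sum_mono mult_right_mono) (auto simp: lp_le_infinity_iff)
    also have "\<dots> \<le> d * c"
      using x c d 1 unfolding sum_distrib_left[symmetric]
      by (intro mult_left_mono) (simp_all add: lp_le_finite_iff)
    finally show ?thesis .
  next
    case 2
    then have "(\<Sum>i<n. norm (\<alpha> i) * norm (x i)) \<le> (\<Sum>i<n. norm (\<alpha> i) * c)"
      using x by (intro sum_mono mult_left_mono) (auto simp: lp_le_infinity_iff)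
    also have "\<dots> \<le> d * c"
      using \<alpha> c d 2 unfolding sum_distrib_right[symmetric]
      by (intro mult_right_mono) (simp_all add: lp_le_finite_iff)
    finally show ?thesis .
  next
    case 3
    let ?r = "enn2real p" and ?q = "enn2real (conj_exponent p)"
    show ?thesis
    proof (cases "c = 0 \<or> d = 0")
      case True
      then have "norm (\<alpha> i) * norm (x i) = 0" for i
        using lp_le_coord[OF p x, of i] lp_le_coord[OF conj_exponent_ge_1[OF p] \<alpha>, of i] by auto
      then show ?thesis using c d by (simp only: sum.neutral_const mult_nonneg_nonneg)
    next
      case False
      then have cd: "0 < c" "0 < d" using c d by auto
      have "(\<Sum>i<n. norm (\<alpha> i) * norm (x i)) / (d * c) = (\<Sum>i<n. (norm (\<alpha> i) / d) * (norm (x i) / c))"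
        by (simp add: sum_divide_distrib)
      also have "\<dots> \<le> (\<Sum>i<n. (norm (\<alpha> i) / d) powr ?q / ?q + (norm (x i) / c) powr ?r / ?r)"
        using 3 cd by (intro sum_mono Youngs_inequality) auto
      also have "\<dots> = (\<Sum>i<n. norm (\<alpha> i) powr ?q) / d powr ?q / ?q
          + (\<Sum>i<n. norm (x i) powr ?r) / c powr ?r / ?r"
        using cd by (simp add: sum.distrib powr_divide sum_divide_distrib)
      also have "\<dots> \<le> 1 / ?q + 1 / ?r"
        using 3 cd x \<alpha> p conj_exponent_ge_1[OF p]
        by (intro add_mono divide_right_mono) (auto simp: lp_le_finite_iff divide_le_eq_1)
      also have "\<dots> = 1" using 3 by simp
      finally show ?thesis
        using cd by (simp add: pos_divide_le_eq del: times_divide_eq_right)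
    qed
  qed
  show s: "summable (\<lambda>n. norm (\<alpha> n) * norm (x n))"
    using bound by (intro summableI_nonneg_bounded) auto
  show "(\<Sum>n. norm (\<alpha> n) * norm (x n)) \<le> d * c"
    using bound by (intro suminf_le_const[OF s])
qed

section \<open>Sets bounded in the sense of $p$-compactness\<close>

text \<open>One framework for real and complex spaces. The sort \<open>heine_borel\<close> makes the
  closed unit ball of scalars compact, which is what allows coefficients to be rounded to finitely
  many values.\<close>

locale scalar_action =
  fixes s :: "'k::{real_normed_field, heine_borel} \<Rightarrow> 'a::banach \<Rightarrow> 'a"
  assumes s_add_right: "s c (x + y) = s c x + s c y"
    and s_add_left: "s (c + d) x = s c x + s d x"
    and s_s: "s c (s d x) = s (c * d) x"
    and s_of_real: "s (of_real r) x = r *\<^sub>R x"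
    and norm_s: "norm (s c x) = norm c * norm x"
begin

lemma s_zero_right [simp]: "s c 0 = 0"
  using norm_s[of c 0] by simp

lemma s_zero_left [simp]: "s 0 x = 0"
  using norm_s[of 0 x] by simp

lemma s_one [simp]: "s 1 x = x"
  using s_of_real[of 1 x] by simp

lemma s_scaleR: "s c (r *\<^sub>R x) = s (c * of_real r) x"
  by (simp add: s_s flip: s_of_real)

text \<open>A positive factor may be shifted between coefficient and vector without changing the
  summand; all estimates of hulls below balance the two in this way.\<close>

lemma s_rescale: "t \<noteq> 0 \<Longrightarrow> s (c * of_real t) ((1 / t) *\<^sub>R x) = s c x"
  unfolding s_scaleR by (simp add: mult.assoc flip: of_real_mult)

lemma s_diff_left: "s (c - d) x = s c x - s d x"
  using s_add_left[of "c - d" d x] by simp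

lemma bounded_linear_s: "bounded_linear (s c)"
proof (rule bounded_linear_intro)
  show "s c (r *\<^sub>R x) = r *\<^sub>R s c x" for r x
    by (simp add: s_s mult.commute flip: s_of_real)
  show "norm (s c x) \<le> norm x * norm c" for x
    by (simp add: norm_s mult.commute)
qed (rule s_add_right)

end

text \<open>Asks for a witness within the bound \<open>c\<close>, so that no infimum has to be
  approximated during the constructions; \<open>p_measure\<close> is the infimum of all such
  \<open>c\<close>.\<close>

definition p_bounded ::
  "('k::real_normed_field \<Rightarrow> 'a::banach \<Rightarrow> 'a) \<Rightarrow> ennreal \<Rightarrow> real \<Rightarrow> 'a set \<Rightarrow> bool" where
  "p_bounded s p c A \<longleftrightarrow> (\<exists>x. lp_le p c x \<and> A \<subseteq> p_hull s p x)"

lemma mem_p_hull_iff: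
  "y \<in> p_hull s p x \<longleftrightarrow>
    (\<exists>\<alpha>. lp_le (conj_exponent p) 1 \<alpha> \<and> (\<lambda>n. s (\<alpha> n) (x n)) sums y)"
  by (simp add: p_hull_def lp_le_def)

lemma p_bounded_subset: "p_bounded s p c A \<Longrightarrow> B \<subseteq> A \<Longrightarrow> p_bounded s p c B"
  by (auto simp: p_bounded_def)

lemma p_bounded_weaken: "p_bounded s p c A \<Longrightarrow> c \<le> d \<Longrightarrow> p_bounded s p d A"
  by (auto simp: p_bounded_def intro: lp_le_weaken)

lemma p_bounded_nonneg: "p_bounded s p c A \<Longrightarrow> 0 \<le> c"
  by (auto simp: p_bounded_def intro: lp_le_nonneg)

lemma p_compact_iff_p_bounded: "p_compact z p A \<longleftrightarrow> (\<exists>c. p_bounded z p c A)"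
  by (auto simp: p_compact_def p_bounded_def lp_le_def)

text \<open>If the set is not p-compact, the right-hand side is the infimum of the empty set in
  \<open>ennreal\<close>, which is \<infinity>, so no case distinction remains.\<close>

lemma p_measure_eq_Inf_p_bounded:
  "p_measure z p A = Inf {ennreal c | c. p_bounded z p c A}"
proof (cases "p_compact z p A")
  case True
  have "Inf {ennreal (lp_norm p x) | x. in_lp p x \<and> A \<subseteq> p_hull z p x}
      = Inf {ennreal c | c. p_bounded z p c A}"
  proof (rule antisym)
    show "Inf {ennreal (lp_norm p x) | x. in_lp p x \<and> A \<subseteq> p_hull z p x}
        \<le> Inf {ennreal c | c. p_bounded z p c A}"
    proof (rule Inf_greatest, clarsimp simp: p_bounded_def lp_le_def)
      fix c x assume x: "in_lp p x" "A \<subseteq> p_hull z p x" "lp_norm p x \<le> c"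
      have "Inf {ennreal (lp_norm p x) | x. in_lp p x \<and> A \<subseteq> p_hull z p x} \<le> ennreal (lp_norm p x)"
        using x by (intro Inf_lower) auto
      also have "\<dots> \<le> ennreal c"
        using x by (intro ennreal_leI)
      finally show "Inf {ennreal (lp_norm p x) | x. in_lp p x \<and> A \<subseteq> p_hull z p x} \<le> ennreal c" .
    qed
    show "Inf {ennreal c | c. p_bounded z p c A}
        \<le> Inf {ennreal (lp_norm p x) | x. in_lp p x \<and> A \<subseteq> p_hull z p x}"
      by (rule Inf_superset_mono) (auto simp: p_bounded_def lp_le_def)
  qed
  then show ?thesis
    using True by (simp add: p_measure_def)
next
  case False
  then have "{ennreal c | c. p_bounded z p c A} = {}"
    by (simp add: p_compact_iff_p_bounded)
  then show ?thesis
    using False by (simp add: p_measure_def)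
qed

text \<open>
  Summable weights \<open>l\<close> serve for all exponents at once: distributing them between coefficients and
  vectors avoids the optimal splitting in Hoelder's inequality, at the price of a constant
  that can be made arbitrarily close to 1 when one summand dominates.
\<close>

definition weight :: "real \<Rightarrow> nat \<Rightarrow> real" where
  "weight t j = (if j = 0 then 1 - t else t * (1 / 2) ^ j)"

lemma weight_sums: "weight t sums 1"
proof -
  have "(\<lambda>j. t * (1 / 2) ^ Suc j) sums t"
    using sums_mult[OF geometric_sums[of "1 / 2 :: real"], of "t / 2"] by simp
  then have "(\<lambda>j. weight t (Suc j)) sums t"
    by (simp add: weight_def)
  then show ?thesis
    by (subst (asm) sums_Suc_iff) (simp add: weight_def)
qed

lemma weight_pos: "0 < t \<Longrightarrow> t < 1 \<Longrightarrow> 0 < weight t j"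
  by (simp add: weight_def)

context scalar_action
begin

text \<open>Row \<open>j\<close> has its vectors divided by \<open>l j\<close> and its coefficients
  multiplied by \<open>l j\<close>. The merged coefficients then have norm at most the total weight
  1, and the merged vectors at most \<open>C\<close>.\<close>

lemma p_bounded_sums:
  assumes p: "1 \<le> p" and A: "\<And>j. p_bounded s p (c j) (A j)"
    and l: "\<And>j. 0 < l j" "l sums 1" and cl: "(\<lambda>j. c j / l j) sums C"
  shows "p_bounded s p C {y. \<exists>a. (\<forall>j. a j \<in> A j) \<and> a sums y}"
proof -
  obtain x where x: "\<And>j. lp_le p (c j) (x j)" "\<And>j. A j \<subseteq> p_hull s p (x j)"
    using A unfolding p_bounded_def by metis
  define z where "z i = (case prod_decode i of (j, n) \<Rightarrow> (1 / l j) *\<^sub>R x j n)" for i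
  have z: "lp_le p C z"
  proof -
    have "lp_le p (c j / l j) (\<lambda>n. (1 / l j) *\<^sub>R x j n)" for j
      using lp_le_scale[OF p x(1), of "1 / l j" "\<lambda>n. (1 / l j) *\<^sub>R x j n" j] l(1)[of j] by simp
    from lp_le_rows[of p "\<lambda>j. c j / l j" "\<lambda>j n. (1 / l j) *\<^sub>R x j n", OF p this] show ?thesis
      using sums_unique[OF cl] sums_summable[OF cl] by (simp add: z_def[abs_def])
  qed
  have "y \<in> p_hull s p z" if a: "\<And>j. a j \<in> A j" "a sums y" for a y
  proof -
    have "\<exists>\<alpha>. lp_le (conj_exponent p) 1 \<alpha> \<and> (\<lambda>n. s (\<alpha> n) (x j n)) sums a j" for j
      using a(1)[of j] x(2)[of j] by (auto simp: mem_p_hull_iff)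
    then obtain \<alpha> where \<alpha>: "\<And>j. lp_le (conj_exponent p) 1 (\<alpha> j)"
      "\<And>j. (\<lambda>n. s (\<alpha> j n) (x j n)) sums a j" by metis
    define \<gamma> where "\<gamma> i = (case prod_decode i of (j, n) \<Rightarrow> \<alpha> j n * of_real (l j))" for i
    note q = conj_exponent_ge_1[OF p]
    have \<gamma>: "lp_le (conj_exponent p) 1 \<gamma>"
    proof -
      have "lp_le (conj_exponent p) (l j) (\<lambda>n. \<alpha> j n * of_real (l j))" for j
        using lp_le_scale[OF q \<alpha>(1), of "l j" "\<lambda>n. \<alpha> j n * of_real (l j)" j] l(1)[of j]
        by (simp add: norm_mult)
      from lp_le_rows[of _ l "\<lambda>j n. \<alpha> j n * of_real (l j)", OF q this] show ?thesis
        using sums_unique[OF l(2)] sums_summable[OF l(2)] by (simp add: \<gamma>_def[abs_def])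
    qed
    define f where "f = (\<lambda>(j, n). s (\<alpha> j n) (x j n))"
    have l_nonzero: "l j \<noteq> 0" for j
      using l(1)[of j] by simp
    have term_eq: "s (\<gamma> i) (z i) = f (prod_decode i)" for i
      using s_rescale[OF l_nonzero] unfolding \<gamma>_def z_def f_def by (cases "prod_decode i") (simp only: prod.case)
    have norm_sum: "summable (\<lambda>i. norm (f (prod_decode i)))"
      unfolding term_eq[symmetric] norm_s by (rule lp_le_Holder(1)[OF p z \<gamma>])
    obtain S where S: "(\<lambda>i. f (prod_decode i)) sums S"
      using summable_sums[OF summable_norm_cancel[OF norm_sum]] by blast
    \<comment> \<open>Hoelder's inequality gives absolute convergence, so the single series over
      pairs may be summed row by row, which recovers the sum of the \<open>a j\<close>.\<close>
    have "((\<lambda>i. f (prod_decode i)) has_sum S) UNIV"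
      by (rule norm_summable_imp_has_sum[OF norm_sum S])
    then have f_sum: "(f has_sum S) (Sigma UNIV (\<lambda>_. UNIV))"
      by (subst (asm) has_sum_reindex_bij_betw[OF bij_prod_decode]) simp
    have "((\<lambda>n. f (j, n)) has_sum a j) UNIV" for j
    proof (rule norm_summable_imp_has_sum)
      show "summable (\<lambda>n. norm (f (j, n)))"
        using lp_le_Holder(1)[OF p x(1) \<alpha>(1), of j j] by (simp add: f_def norm_s)
    qed (simp add: f_def \<alpha>(2))
    then have "(a has_sum S) UNIV"
      by (rule has_sum_SigmaD[OF f_sum])
    then have "S = y"
      by (rule sums_unique2[OF has_sum_imp_sums a(2)])
    then show ?thesis
      using \<gamma> S unfolding mem_p_hull_iff by (intro exI[of _ \<gamma>]) (simp add: term_eq)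
  qed
  then have "{y. \<exists>a. (\<forall>j. a j \<in> A j) \<and> a sums y} \<subseteq> p_hull s p z"
    by blast
  then show ?thesis
    using z unfolding p_bounded_def by blast
qed

text \<open>The points themselves serve as vectors and unit sequences as coefficients. The sum of
  the norms is wasteful, but it is applied only to error terms.\<close>

lemma p_bounded_finite:
  assumes p: "1 \<le> p"
  shows "p_bounded s p (\<Sum>i<m. norm (e i)) (e ` {..<m::nat})"
proof -
  define x where "x n = (if n < m then e n else 0)" for n
  have "lp_le p (\<Sum>n<m. norm (x n)) x"
    by (rule lp_le_finite_support[OF p]) (simp add: x_def)
  then have x: "lp_le p (\<Sum>i<m. norm (e i)) x"
    by (simp add: x_def)
  have "e i \<in> p_hull s p x" if i: "i < m" for i
  proof -
    define \<alpha> :: "nat \<Rightarrow> 'k" where "\<alpha> n = (if n = i then 1 else 0)" for n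
    have "lp_le (conj_exponent p) (\<Sum>n<Suc i. norm (\<alpha> n)) \<alpha>"
      by (rule lp_le_finite_support[OF conj_exponent_ge_1[OF p]]) (simp add: \<alpha>_def)
    then have "lp_le (conj_exponent p) 1 \<alpha>"
      by (simp add: \<alpha>_def)
    moreover have "(\<lambda>n. s (\<alpha> n) (x n)) sums e i"
    proof -
      have "s (\<alpha> n) (x n) = (if n = i then e n else 0)" for n
        using i by (simp add: \<alpha>_def x_def)
      then show ?thesis
        using sums_single[of i e] by simp
    qed
    ultimately show ?thesis by (auto simp: mem_p_hull_iff)
  qed
  then show ?thesis
    using x by (auto simp: p_bounded_def)
qed

lemma p_bounded_zero: "1 \<le> p \<Longrightarrow> p_bounded s p 0 {0}"
  using p_bounded_finite[of p "\<lambda>_. 0" 1] by (simp add: lessThan_Suc)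

text \<open>The case of two nontrivial rows, all others being {0}. Their weights are 1 - t and t /
  2, whence the factor 2 at \<open>d\<close>.\<close>

lemma p_bounded_add:
  assumes p: "1 \<le> p" and A: "p_bounded s p c A" and B: "p_bounded s p d B" and t: "0 < t" "t < 1"
  shows "p_bounded s p (c / (1 - t) + 2 * d / t) {a + b | a b. a \<in> A \<and> b \<in> B}"
proof -
  define e where "e j = (if j = 0 then c else if j = 1 then d else 0)" for j :: nat
  define D where "D j = (if j = 0 then A else if j = 1 then B else {0})" for j :: nat
  have "(\<lambda>j. e j / weight t j) sums (\<Sum>j\<in>{0, 1}. e j / weight t j)"
    by (rule sums_finite) (auto simp: e_def)
  then have sum_e: "(\<lambda>j. e j / weight t j) sums (c / (1 - t) + 2 * d / t)"
    by (simp add: e_def weight_def mult.commute)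
  have "p_bounded s p (e j) (D j)" for j
    using A B p_bounded_zero[OF p] by (simp add: e_def D_def)
  then have "p_bounded s p (c / (1 - t) + 2 * d / t) {y. \<exists>a. (\<forall>j. a j \<in> D j) \<and> a sums y}"
    by (rule p_bounded_sums[OF p _ weight_pos[OF t] weight_sums sum_e])
  then show ?thesis
  proof (rule p_bounded_subset, safe)
    fix a b assume ab: "a \<in> A" "b \<in> B"
    let ?f = "\<lambda>j. if j = 0 then a else if j = Suc 0 then b else 0"
    have "?f sums (\<Sum>j\<in>{0, 1}. ?f j)"
      by (rule sums_finite) auto
    then show "\<exists>f. (\<forall>j. f j \<in> D j) \<and> f sums (a + b)"
      using ab by (intro exI[of _ ?f]) (auto simp: D_def)
  qed
qed

text \<open>Converts small measure into small norm; this makes the remainders of the iteration tend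
  to 0.\<close>

lemma p_hull_norm_le:
  assumes p: "1 \<le> p" and x: "lp_le p c x" and y: "y \<in> p_hull s p x"
  shows "norm y \<le> c"
proof -
  obtain \<alpha> where \<alpha>: "lp_le (conj_exponent p) 1 \<alpha>" "(\<lambda>n. s (\<alpha> n) (x n)) sums y"
    using y by (auto simp: mem_p_hull_iff)
  have "norm (\<Sum>n. s (\<alpha> n) (x n)) \<le> (\<Sum>n. norm (s (\<alpha> n) (x n)))"
    using lp_le_Holder(1)[OF p x \<alpha>(1)] by (intro summable_norm) (simp add: norm_s)
  then show ?thesis
    using lp_le_Holder(2)[OF p x \<alpha>(1)] \<alpha>(2) by (simp add: norm_s sums_iff)
qed

end

section \<open>Finite approximation\<close>

text \<open>Otherwise \<open>h\<close> would stay below \<open>norm h * r - e\<close> on the ball of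
  radius \<open>r\<close>, making its norm too small. Radius 0 is included because entries of
  \<open>w\<close> may vanish.\<close>

lemma almost_norming_vector:
  fixes h :: "'a::real_normed_vector \<Rightarrow>\<^sub>L real"
  assumes "0 \<le> r" "0 < e"
  shows "\<exists>x. norm x \<le> r \<and> norm h * r - e \<le> blinfun_apply h x"
proof (rule ccontr)
  assume "\<not> ?thesis"
  then have less: "blinfun_apply h x < norm h * r - e" if "norm x \<le> r" for x
    using that by force
  have pos: "0 < norm h * r - e"
    using less[of 0] assms by simp
  then have r: "0 < r"
    using assms by (cases "r = 0") auto
  have bound: "blinfun_apply h y \<le> (norm h * r - e) / r * norm y" for y
  proof (cases "y = 0")
    case False
    then have "blinfun_apply h ((r / norm y) *\<^sub>R y) < norm h * r - e"
      using r by (intro less) simp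
    then show ?thesis
      using False r by (simp add: blinfun.scaleR_right field_simps)
  qed simp
  have "norm h \<le> (norm h * r - e) / r"
  proof (rule norm_blinfun_bound)
    show "norm (blinfun_apply h y) \<le> (norm h * r - e) / r * norm y" for y
      using bound[of y] bound[of "- y"] by (simp add: blinfun.minus_right abs_le_iff)
  qed (use pos r in simp)
  then show False
    using r assms by (simp add: field_simps)
qed

text \<open>Cover the unit ball of scalars by finitely many balls of radius d / 2 and group the
  indices by the balls chosen for their first \<open>N\<close> coefficients. Representatives are
  picked inside \<open>K\<close>, which keeps all differences in E.\<close>

lemma finite_cells:
  fixes \<alpha> :: "'i \<Rightarrow> nat \<Rightarrow> 'k::{real_normed_vector, heine_borel}"
  assumes bound: "\<And>k n. k \<in> K \<Longrightarrow> norm (\<alpha> k n) \<le> 1" and d: "0 < d"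
  obtains \<rho> where "\<rho> ` K \<subseteq> K" "finite (\<rho> ` K)"
    "\<And>k n. k \<in> K \<Longrightarrow> n < N \<Longrightarrow> norm (\<alpha> k n - \<alpha> (\<rho> k) n) < d"
proof -
  obtain T where T: "finite T" "cball (0 :: 'k) 1 \<subseteq> (\<Union>t\<in>T. ball t (d / 2))"
    using compact_cball[of "0 :: 'k" 1] half_gt_zero[OF d] unfolding compact_eq_totally_bounded
    by meson
  have "\<exists>t\<in>T. dist t c < d / 2" if "norm c \<le> 1" for c
    using T(2) that by (force simp: subset_iff)
  then obtain cl where cl: "\<And>c. norm c \<le> 1 \<Longrightarrow> cl c \<in> T \<and> dist (cl c) c < d / 2"
    by metis
  define \<phi> where "\<phi> k = restrict (\<lambda>n. cl (\<alpha> k n)) {..<N}" for k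
  have "\<phi> ` K \<subseteq> {..<N} \<rightarrow>\<^sub>E T"
    unfolding \<phi>_def image_subset_iff restrict_PiE_iff using cl bound by blast
  then have fin: "finite (\<phi> ` K)"
    by (rule finite_subset) (simp add: finite_PiE T)
  define \<rho> where "\<rho> k = inv_into K \<phi> (\<phi> k)" for k
  have \<rho>: "\<rho> k \<in> K" "\<phi> (\<rho> k) = \<phi> k" if "k \<in> K" for k
    using that by (auto simp: \<rho>_def inv_into_into f_inv_into_f)
  show thesis
  proof (rule that[of \<rho>])
    show "finite (\<rho> ` K)"
      unfolding \<rho>_def using finite_imageI[OF fin, of "inv_into K \<phi>"] by (simp add: image_image)
    fix k n assume k: "k \<in> K" and n: "n < N"
    have "cl (\<alpha> (\<rho> k) n) = cl (\<alpha> k n)"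
      using fun_cong[OF \<rho>(2)[OF k], of n] n by (simp add: \<phi>_def)
    then have "dist (cl (\<alpha> k n)) (\<alpha> k n) < d / 2" "dist (cl (\<alpha> k n)) (\<alpha> (\<rho> k) n) < d / 2"
      using cl[OF bound[OF k, of n]] cl[OF bound[OF \<rho>(1)[OF k], of n]] by auto
    then have "dist (\<alpha> k n) (\<alpha> (\<rho> k) n) < d"
      by (metis dist_commute dist_triangle_half_r)
    then show "norm (\<alpha> k n - \<alpha> (\<rho> k) n) < d"
      by (simp add: dist_norm)
  qed (use \<rho> in auto)
qed

text \<open>Finite tuples over E, of a length \<open>m\<close> that is a term and not a type, are
  modelled as bounded sequences. The supremum norm controls every coordinate of a tuple at
  once.\<close>

definition seq_unit :: "nat \<Rightarrow> 'a::real_normed_vector \<Rightarrow> nat \<Rightarrow>\<^sub>C 'a" where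
  "seq_unit i x = Bcontfun (\<lambda>j. if j = i then x else 0)"

lemma apply_seq_unit: "apply_bcontfun (seq_unit i x) j = (if j = i then x else 0)"
proof -
  have "(\<lambda>j. if j = i then x else 0) \<in> bcontfun"
    by (rule bcontfun_normI[of _ "norm x"]) auto
  then show ?thesis
    by (simp add: seq_unit_def Bcontfun_inverse)
qed

lemma bounded_linear_seq_unit: "bounded_linear (seq_unit i)"
proof (rule bounded_linear_intro)
  show "norm (seq_unit i x) \<le> norm x * 1" for x :: 'a
    by (rule norm_bound) (simp add: apply_seq_unit)
qed (auto intro!: bcontfun_eqI simp: apply_seq_unit)

lemma norm_seq_unit_le: "norm (seq_unit i x) \<le> norm x"
  by (rule norm_bound) (simp add: apply_seq_unit)

text \<open>From E'' only an embedding and a norm non-increasing extension \<open>R\<close> of real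
  functionals are taken. \<open>R_s\<close> expresses compatibility with scalars through a
  functional \<open>g\<close> equal to \<open>f\<close> composed with \<open>s c\<close>, so that
  this composition need not be built as a \<open>blinfun\<close>.\<close>

locale functional_extension = E: scalar_action s + F: scalar_action s'
  for s :: "'k::{real_normed_field, heine_borel} \<Rightarrow> 'a::banach \<Rightarrow> 'a"
    and s' :: "'k \<Rightarrow> 'b::banach \<Rightarrow> 'b" +
  fixes J :: "'a \<Rightarrow> 'b" and R :: "('a \<Rightarrow>\<^sub>L real) \<Rightarrow> ('b \<Rightarrow>\<^sub>L real)"
  assumes bounded_linear_J: "bounded_linear J"
    and norm_J_le: "norm (J x) \<le> norm x"
    and J_s: "J (s c x) = s' c (J x)"
    and R_add: "R (f + g) = R f + R g"
    and norm_R_le: "norm (R f) \<le> norm f"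
    and R_J: "blinfun_apply (R f) (J x) = blinfun_apply f x"
    and R_s: "(\<And>x. blinfun_apply g x = blinfun_apply f (s c x)) \<Longrightarrow>
      blinfun_apply (R g) y = blinfun_apply (R f) (s' c y)"
begin

lemma norm_J: "norm (J x) = norm x"
proof (rule antisym[OF norm_J_le])
  obtain f where f: "norm f \<le> 1" "blinfun_apply f x = norm x"
    using norming_functional by blast
  have "norm x = blinfun_apply (R f) (J x)"
    by (simp add: R_J f)
  also have "\<dots> \<le> norm (R f) * norm (J x)"
    using norm_blinfun[of "R f" "J x"] by simp
  also have "\<dots> \<le> 1 * norm (J x)"
    using norm_R_le[of f] f(1) by (intro mult_right_mono) auto
  finally show "norm x \<le> norm (J x)" by simp
qed

lemma R_sum: "R (\<Sum>i\<in>A. f i) = (\<Sum>i\<in>A. R (f i))"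
proof -
  interpret additive R by standard (rule R_add)
  show ?thesis by (rule sum)
qed

text \<open>
  The bounds \<open>norm (x n) \<le> norm (w n)\<close> are pointwise, so that the approximation does not depend on
  the exponent: if it failed, a separating functional on \<open>\<ell>\<^sub>\<infinity>\<close>-sequences would give
  functionals \<open>g n\<close> with \<open>(\<Sum>n. norm (g n) * norm (w n)) < (\<Sum>n. R (g n) (w n))\<close>.
\<close>

lemma finite_approximation:
  fixes a :: "nat \<Rightarrow> nat \<Rightarrow> 'k" and w :: "nat \<Rightarrow> 'b"
  assumes sums: "\<And>i. i < m \<Longrightarrow> (\<lambda>n. s' (a i n) (w n)) sums J (k i)" and d: "0 < d"
  obtains x N where "\<And>n. norm (x n) \<le> norm (w n)" "\<And>n. N \<le> n \<Longrightarrow> x n = 0"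
    "\<And>i. i < m \<Longrightarrow> norm (k i - (\<Sum>n<N. s (a i n) (x n))) < d"
proof -
  \<comment> \<open>Truncating the series costs \<eta> times \<open>norm f\<close> for each of the
    \<open>m\<close> points; the total stays strictly below the gap
    \<open>d * norm f\<close>.\<close>
  define \<eta> where "\<eta> = d / (2 * (real m + 1))"
  have \<eta>: "0 < \<eta>" "real m * \<eta> < d"
    using d by (auto simp: \<eta>_def field_simps add_nonneg_pos)
  have "\<forall>\<^sub>F N in sequentially. \<forall>i\<in>{..<m}. dist (\<Sum>n<N. s' (a i n) (w n)) (J (k i)) < \<eta>"
    using sums \<eta>(1) by (intro eventually_ball_finite) (auto simp: sums_def tendsto_iff)
  then obtain N where N: "\<And>i. i < m \<Longrightarrow> norm (J (k i) - (\<Sum>n<N. s' (a i n) (w n))) < \<eta>"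
    by (auto simp: eventually_sequentially dist_norm norm_minus_commute)
  \<comment> \<open>\<Phi> sends \<open>x\<close> to the tuple of its \<open>m\<close> truncated
    combinations. It is real-linear, so the admissible \<open>x\<close> have a convex image
    \<open>C\<close>, to be compared with the target tuple \<open>v\<close>.\<close>
  define \<Phi> where "\<Phi> x = (\<Sum>i<m. seq_unit i (\<Sum>n<N. s (a i n) (x n)))" for x
  define C where "C = \<Phi> ` {x. \<forall>n. norm (x n) \<le> norm (w n)}"
  define v where "v = (\<Sum>i<m. seq_unit i (k i))"
  have apply_sum: "apply_bcontfun (\<Sum>i<m. seq_unit i (y i)) j = (if j < m then y j else 0)"
    for y :: "nat \<Rightarrow> 'a" and j
  proof -
    have "apply_bcontfun (\<Sum>i\<in>A. seq_unit i (y i)) j = (\<Sum>i\<in>A. apply_bcontfun (seq_unit i (y i)) j)" for A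
      by (induction A rule: infinite_finite_induct) auto
    then show ?thesis
      by (simp add: apply_seq_unit sum.delta)
  qed
  have "\<exists>c\<in>C. dist v c < d"
  proof (rule ccontr)
    assume "\<not> ?thesis"
    then have far: "d \<le> dist v c" if "c \<in> C" for c
      using that by force
    have \<Phi>_comb: "\<Phi> (\<lambda>n. u *\<^sub>R x n + t *\<^sub>R y n) = u *\<^sub>R \<Phi> x + t *\<^sub>R \<Phi> y" for u t x y
    proof -
      interpret linear "s c" for c
        by (rule bounded_linear.linear[OF E.bounded_linear_s])
      interpret U: linear "seq_unit i :: 'a \<Rightarrow> _" for i
        by (rule bounded_linear.linear[OF bounded_linear_seq_unit])
      show ?thesis
        by (simp add: \<Phi>_def add scale U.add U.scale sum.distrib scaleR_sum_right U.sum)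
    qed
    have "convex C"
      unfolding C_def
    proof (rule convexI, safe)
      fix x y :: "nat \<Rightarrow> 'a" and u t :: real
      assume *: "0 \<le> u" "0 \<le> t" "u + t = 1"
        "\<forall>n. norm (x n) \<le> norm (w n)" "\<forall>n. norm (y n) \<le> norm (w n)"
      have "norm (u *\<^sub>R x n + t *\<^sub>R y n) \<le> norm (w n)" for n
        using convexD[OF convex_cball[of 0 "norm (w n)"], of "x n" "y n" u t] * by simp
      then show "u *\<^sub>R \<Phi> x + t *\<^sub>R \<Phi> y \<in> \<Phi> ` {x. \<forall>n. norm (x n) \<le> norm (w n)}"
        unfolding \<Phi>_comb[symmetric] by (intro imageI) simp
    qed
    moreover have "0 \<in> C"
    proof -
      have "\<Phi> (\<lambda>_. 0) = 0"
        using \<Phi>_comb[of 0 "\<lambda>_. 0" 0 "\<lambda>_. 0"] by simp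
      then show ?thesis
        unfolding C_def by (intro image_eqI[of _ _ "\<lambda>_. 0"]) simp_all
    qed
    ultimately obtain f :: "(nat \<Rightarrow>\<^sub>C 'a) \<Rightarrow>\<^sub>L real" where f: "f \<noteq> 0"
        and sep: "\<And>c. c \<in> C \<Longrightarrow> blinfun_apply f c + d * norm f \<le> blinfun_apply f v"
      using separate_point_from_convex[OF _ _ d far] by metis
    define fi where "fi i = Blinfun (\<lambda>x. blinfun_apply f (seq_unit i x))" for i
    have fi: "blinfun_apply (fi i) x = blinfun_apply f (seq_unit i x)" for i x
      unfolding fi_def by (subst bounded_linear_Blinfun_apply)
        (auto intro: bounded_linear_compose[OF blinfun.bounded_linear_right bounded_linear_seq_unit])
    have norm_fi: "norm (fi i) \<le> norm f" for i
    proof (rule norm_blinfun_bound)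
      show "norm (blinfun_apply (fi i) x) \<le> norm f * norm x" for x
        unfolding fi by (rule order_trans[OF norm_blinfun]) (intro mult_left_mono norm_seq_unit_le norm_ge_zero)
    qed simp
    define h where "h i n = Blinfun (\<lambda>x. blinfun_apply (fi i) (s (a i n) x))" for i n
    have h: "blinfun_apply (h i n) x = blinfun_apply (fi i) (s (a i n) x)" for i n x
      unfolding h_def by (subst bounded_linear_Blinfun_apply)
        (auto intro: bounded_linear_compose[OF blinfun.bounded_linear_right E.bounded_linear_s])
    define g where "g n = (\<Sum>i<m. h i n)" for n
    have Rg: "blinfun_apply (R (g n)) y = (\<Sum>i<m. blinfun_apply (R (fi i)) (s' (a i n) y))" for n y
      unfolding g_def R_sum blinfun.sum_left by (intro sum.cong refl R_s) (rule h)
    \<comment> \<open>What is left of the separation gap after truncation; it is shared among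
      \<open>N\<close> almost norming choices, each losing \<epsilon>.\<close>
    define \<mu> where "\<mu> = (d - real m * \<eta>) * norm f"
    have \<mu>: "0 < \<mu>"
      using \<eta> f by (simp add: \<mu>_def)
    define \<epsilon> where "\<epsilon> = \<mu> / (real N + 1)"
    have \<epsilon>: "0 < \<epsilon>" "real N * \<epsilon> < \<mu>"
      using \<mu> by (auto simp: \<epsilon>_def field_simps)
    have "\<exists>y. norm y \<le> norm (w n) \<and> blinfun_apply (R (g n)) (w n) - \<epsilon> \<le> blinfun_apply (g n) y" for n
    proof -
      obtain y where y: "norm y \<le> norm (w n)" "norm (g n) * norm (w n) - \<epsilon> \<le> blinfun_apply (g n) y"
        using almost_norming_vector[OF norm_ge_zero \<epsilon>(1)] by blast
      have "blinfun_apply (R (g n)) (w n) \<le> norm (R (g n)) * norm (w n)"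
        using norm_blinfun[of "R (g n)" "w n"] by simp
      also have "\<dots> \<le> norm (g n) * norm (w n)"
        by (intro mult_right_mono norm_R_le) simp
      finally show ?thesis using y by (intro exI[of _ y]) simp
    qed
    then obtain x where x: "\<And>n. norm (x n) \<le> norm (w n)"
      "\<And>n. blinfun_apply (R (g n)) (w n) - \<epsilon> \<le> blinfun_apply (g n) (x n)" by metis
    \<comment> \<open>The passage to E'': \<open>R\<close> extends each coordinate functional, so
      its value at \<open>k i\<close> can be computed from the series in \<open>w\<close>. Norming
      the \<open>g n\<close> then brings the estimate back to vectors of E.\<close>
    have "blinfun_apply f v = (\<Sum>i<m. blinfun_apply (R (fi i)) (J (k i)))"
      by (simp add: v_def blinfun.sum_right R_J fi)
    also have "\<dots> \<le> (\<Sum>i<m. blinfun_apply (R (fi i)) (\<Sum>n<N. s' (a i n) (w n)) + norm f * \<eta>)"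
    proof (rule sum_mono)
      fix i assume "i \<in> {..<m}"
      then have le: "norm (J (k i) - (\<Sum>n<N. s' (a i n) (w n))) \<le> \<eta>"
        using N[of i] by simp
      have "blinfun_apply (R (fi i)) (J (k i) - (\<Sum>n<N. s' (a i n) (w n)))
          \<le> norm (R (fi i)) * norm (J (k i) - (\<Sum>n<N. s' (a i n) (w n)))"
        using norm_blinfun[of "R (fi i)"] by (metis abs_ge_self order_trans real_norm_def)
      also have "\<dots> \<le> norm f * \<eta>"
        using norm_R_le[of "fi i"] norm_fi[of i] le by (intro mult_mono) auto
      finally show "blinfun_apply (R (fi i)) (J (k i))
          \<le> blinfun_apply (R (fi i)) (\<Sum>n<N. s' (a i n) (w n)) + norm f * \<eta>"
        by (simp add: blinfun.diff_right)
    qed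
    also have "\<dots> = (\<Sum>n<N. blinfun_apply (R (g n)) (w n)) + real m * \<eta> * norm f"
      unfolding Rg by (simp add: sum.distrib blinfun.sum_right sum.swap[of _ "{..<N}"])
    also have "\<dots> \<le> (\<Sum>n<N. blinfun_apply (g n) (x n) + \<epsilon>) + real m * \<eta> * norm f"
      using x(2) by (intro add_right_mono sum_mono) (simp add: algebra_simps)
    also have "\<dots> = blinfun_apply f (\<Phi> x) + real N * \<epsilon> + real m * \<eta> * norm f"
    proof -
      interpret U: linear "seq_unit i :: 'a \<Rightarrow> _" for i
        by (rule bounded_linear.linear[OF bounded_linear_seq_unit])
      show ?thesis
        by (simp add: g_def \<Phi>_def blinfun.sum_left blinfun.sum_right h fi sum.distrib U.sum
            sum.swap[of _ "{..<N}"])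
    qed
    also have "\<dots> < blinfun_apply f (\<Phi> x) + d * norm f"
      using \<epsilon>(2) by (simp add: \<mu>_def algebra_simps)
    also have "\<dots> \<le> blinfun_apply f v"
      using x(1) by (intro sep) (auto simp: C_def)
    finally show False by simp
  qed
  then obtain x where x: "\<And>n. norm (x n) \<le> norm (w n)" "dist v (\<Phi> x) < d"
    by (auto simp: C_def)
  show thesis
  \<comment> \<open>Entries from \<open>N\<close> on do not enter \<Phi>, so they may be set to
    0.\<close>
  proof (rule that[of "\<lambda>n. if n < N then x n else 0" N])
    fix i assume i: "i < m"
    have "dist (apply_bcontfun v i) (apply_bcontfun (\<Phi> x) i) < d"
      using dist_bounded[of v i "\<Phi> x"] x(2) by linarith
    then show "norm (k i - (\<Sum>n<N. s (a i n) (if n < N then x n else 0))) < d"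
      using i by (simp add: v_def \<Phi>_def apply_sum dist_norm)
  qed (use x(1) in auto)
qed

end

section \<open>Transfer from the bidual\<close>

text \<open>The expression is the total cost of the iterated decomposition with weight parameter
  \<open>t\<close>; it tends to \<open>c\<close> as \<open>t\<close> decreases to 0.\<close>

lemma small_total:
  fixes c :: real
  assumes "0 < e"
  obtains t where "0 < t" "t < 1" "(c + t\<^sup>2) / (1 - t) + 5 * t \<le> c + e"
proof -
  have "((\<lambda>t. (c + t\<^sup>2) / (1 - t) + 5 * t) \<longlongrightarrow> (c + 0\<^sup>2) / (1 - 0) + 5 * 0) (at_right 0)"
    by (intro tendsto_intros) auto
  then have "\<forall>\<^sub>F t in at_right 0. (c + t\<^sup>2) / (1 - t) + 5 * t < c + e"
    using assms by (intro order_tendstoD(2)) auto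
  moreover have "\<forall>\<^sub>F t in at_right (0 :: real). t \<in> {0<..<1}"
    by (rule eventually_at_right_real) simp
  ultimately have "\<forall>\<^sub>F t in at_right (0 :: real). 0 < t \<and> t < 1 \<and> (c + t\<^sup>2) / (1 - t) + 5 * t < c + e"
    by eventually_elim auto
  then obtain t where "0 < t \<and> t < 1 \<and> (c + t\<^sup>2) / (1 - t) + 5 * t < c + e"
    using eventually_happens'[OF trivial_limit_at_right_real] by blast
  then show thesis
    by (intro that[of t]) auto
qed

context functional_extension
begin

lemma J_diff: "J (x - y) = J x - J y"
  by (rule linear_diff[OF bounded_linear.linear[OF bounded_linear_J]])

lemma p_bounded_image:
  assumes p: "1 \<le> p" and K: "p_bounded s p c K"
  shows "p_bounded s' p c (J ` K)"
proof -
  obtain x where x: "lp_le p c x" "K \<subseteq> p_hull s p x"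
    using K by (auto simp: p_bounded_def)
  have "lp_le p c (\<lambda>n. J (x n))"
    by (rule lp_le_mono[OF p x(1)]) (rule norm_J_le)
  moreover have "J y \<in> p_hull s' p (\<lambda>n. J (x n))" if y: "y \<in> K" for y
  proof -
    obtain \<alpha> where \<alpha>: "lp_le (conj_exponent p) 1 \<alpha>" "(\<lambda>n. s (\<alpha> n) (x n)) sums y"
      using y x(2) unfolding subset_iff mem_p_hull_iff by blast
    have "(\<lambda>n. s' (\<alpha> n) (J (x n))) sums J y"
      using bounded_linear.sums[OF bounded_linear_J \<alpha>(2)] by (simp add: J_s)
    then show ?thesis
      using \<alpha>(1) by (auto simp: mem_p_hull_iff)
  qed
  ultimately show ?thesis
    by (auto simp: p_bounded_def)
qed

text \<open>The approximants keep the coefficients of the given points and so satisfy the bound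
  \<open>c\<close> exactly. The finitely many errors are added as a second set of negligible
  cost.\<close>

lemma finite_transfer:
  assumes p: "1 \<le> p" and F: "finite F" and w: "p_bounded s' p c (J ` F)" and e: "0 < e"
  shows "p_bounded s p (c + e) F"
proof -
  obtain w where w: "lp_le p c w" "J ` F \<subseteq> p_hull s' p w"
    using w by (auto simp: p_bounded_def)
  note c = lp_le_nonneg[OF w(1)]
  obtain k :: "nat \<Rightarrow> 'a" and m where k: "F = k ` {..<m}"
    using finite_imp_nat_seg_image_inj_on[OF F] by (auto simp: lessThan_def)
  have "\<forall>i. i < m \<longrightarrow> (\<exists>\<alpha>. lp_le (conj_exponent p) 1 \<alpha> \<and> (\<lambda>n. s' (\<alpha> n) (w n)) sums J (k i))"
    using w(2) by (auto simp: k mem_p_hull_iff image_subset_iff)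
  then obtain a where a: "\<And>i. i < m \<Longrightarrow> lp_le (conj_exponent p) 1 (a i)"
    "\<And>i. i < m \<Longrightarrow> (\<lambda>n. s' (a i n) (w n)) sums J (k i)" by metis
  \<comment> \<open>Then 1 - t = (c + e/2) / (c + e), and c (c + e) \<le> (c + e/2)^2 gives c / (1 -
    t) \<le> c + e/2.\<close>
  define t where "t = (e / 2) / (c + e)"
  have t: "0 < t" "t < 1"
    using c e by (auto simp: t_def field_simps)
  \<comment> \<open>The \<open>m\<close> errors, weighted by 2 / t, may use up the other e/2; the
    shift to m + 1 covers empty \<open>F\<close>.\<close>
  define d where "d = e * t / (4 * (real m + 1))"
  have "0 < d"
    using e t by (simp add: d_def add_nonneg_pos)
  moreover have "2 * (real m * d) / t \<le> e / 2"
  proof -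
    have "2 * (real m * d) / t = e / 2 * (real m / (real m + 1))"
      using t by (simp add: d_def divide_simps)
    then show ?thesis
      using e mult_left_le[of "real m / (real m + 1)" "e / 2"] by simp
  qed
  ultimately have d: "0 < d" "2 * (real m * d) / t \<le> e / 2" .
  obtain x N where x: "\<And>n. norm (x n) \<le> norm (w n)" "\<And>n. N \<le> n \<Longrightarrow> x n = 0"
    and err: "\<And>i. i < m \<Longrightarrow> norm (k i - (\<Sum>n<N. s (a i n) (x n))) < d"
    using finite_approximation[of m a w k d] a(2) d(1) by metis
  define u where "u i = (\<Sum>n<N. s (a i n) (x n))" for i
  have "p_bounded s p c (u ` {..<m})"
    unfolding p_bounded_def
  proof (intro exI conjI image_subsetI)
    show "lp_le p c x"
      by (rule lp_le_mono[OF p w(1) x(1)])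
    fix i assume i: "i \<in> {..<m}"
    have "(\<lambda>n. s (a i n) (x n)) sums u i"
      unfolding u_def by (rule sums_finite) (use x(2) in auto)
    then show "u i \<in> p_hull s p x"
      using a(1) i by (auto simp: mem_p_hull_iff)
  qed
  then have "p_bounded s p (c / (1 - t) + 2 * (\<Sum>i<m. norm (k i - u i)) / t)
      {y + z | y z. y \<in> u ` {..<m} \<and> z \<in> (\<lambda>i. k i - u i) ` {..<m}}"
    by (rule E.p_bounded_add[OF p _ E.p_bounded_finite[OF p] t])
  moreover have "F \<subseteq> {y + z | y z. y \<in> u ` {..<m} \<and> z \<in> (\<lambda>i. k i - u i) ` {..<m}}"
  proof
    fix f assume "f \<in> F"
    then obtain i where "i < m" "f = u i + (k i - u i)"
      by (auto simp: k)
    then show "f \<in> {y + z | y z. y \<in> u ` {..<m} \<and> z \<in> (\<lambda>i. k i - u i) ` {..<m}}"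
      by blast
  qed
  moreover have "c / (1 - t) + 2 * (\<Sum>i<m. norm (k i - u i)) / t \<le> c + e"
  proof -
    have "c / (1 - t) \<le> c + e / 2"
    proof -
      have "(c + e / 2) * (1 - t) = (c + e / 2) * (c + e / 2) / (c + e)"
        using c e by (simp add: t_def field_simps)
      moreover have "c \<le> (c + e / 2) * (c + e / 2) / (c + e)"
        using c e by (simp add: pos_le_divide_eq) (simp add: algebra_simps)
      ultimately show ?thesis
        using t by (simp add: pos_divide_le_eq)
    qed
    moreover have "2 * (\<Sum>i<m. norm (k i - u i)) / t \<le> e / 2"
    proof -
      have "(\<Sum>i<m. norm (k i - u i)) \<le> (\<Sum>i<m. d)"
        using err by (intro sum_mono) (simp add: u_def less_imp_le)
      then have "2 * (\<Sum>i<m. norm (k i - u i)) / t \<le> 2 * (real m * d) / t"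
        using t by (intro divide_right_mono) auto
      then show ?thesis using d(2) by linarith
    qed
    ultimately show ?thesis by linarith
  qed
  ultimately show ?thesis
    by (meson p_bounded_subset p_bounded_weaken)
qed

text \<open>
  Elements of \<open>K\<close> are rounded to finitely many elements of \<open>K\<close> with nearly the same leading
  coefficients. The differences are represented by the same vectors, with the leading ones made
  short by enlarging their small coefficients and the remaining ones short already.
\<close>

lemma finite_plus_small:
  assumes p: "1 \<le> p" and K: "p_bounded s' p c (J ` K)" and e: "0 < e"
  obtains F G where "p_bounded s p (c + e) F" "p_bounded s' p e (J ` G)"
    "\<And>k. k \<in> K \<Longrightarrow> \<exists>f\<in>F. k - f \<in> G"
proof -
  note q = conj_exponent_ge_1[OF p]
  obtain w where w: "lp_le p c w" "J ` K \<subseteq> p_hull s' p w"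
    using K by (auto simp: p_bounded_def)
  note c = lp_le_nonneg[OF w(1)]
  have "\<forall>k. k \<in> K \<longrightarrow> (\<exists>\<alpha>. lp_le (conj_exponent p) 1 \<alpha> \<and> (\<lambda>n. s' (\<alpha> n) (w n)) sums J k)"
    using w(2) by (auto simp: mem_p_hull_iff image_subset_iff)
  then obtain \<alpha> where \<alpha>: "\<And>k. k \<in> K \<Longrightarrow> lp_le (conj_exponent p) 1 (\<alpha> k)"
    "\<And>k. k \<in> K \<Longrightarrow> (\<lambda>n. s' (\<alpha> k n) (w n)) sums J k" by metis
  \<comment> \<open>The tail will be stretched by 16, giving e/4. The head contributes c / M \<le>
    e/4, and the factor 2 in \<open>lp_le_add\<close> brings the total to \<open>e\<close>.\<close>
  obtain N where N: "lp_le p (e / 64) (\<lambda>n. if n < N then 0 else w n)"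
    using lp_le_tail[OF p, of w "e / 64"] w(1) e by (auto simp: lp_le_def)
  define M where "M = 4 * (c + 1) / e"
  have M: "0 < M" "c / M \<le> e / 4"
    using c e by (auto simp: M_def field_simps)
  \<comment> \<open>Keeps the 1-norm of the \<open>N\<close> leading coefficient differences at most
    1/4 after enlarging them by \<open>M\<close>.\<close>
  define d where "d = 1 / (4 * (real N + 1) * M)"
  have "0 < d"
    using M by (simp add: d_def add_nonneg_pos)
  moreover have "real N * (M * d) \<le> 1 / 4"
  proof -
    have "real N * (M * d) = 1 / 4 * (real N / (real N + 1))"
      using M by (simp add: d_def)
    then show ?thesis by simp
  qed
  ultimately have d: "0 < d" "real N * (M * d) \<le> 1 / 4" .
  have "norm (\<alpha> k n) \<le> 1" if "k \<in> K" for k n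
    by (rule lp_le_coord[OF q \<alpha>(1)[OF that]])
  then obtain \<rho> where \<rho>: "\<rho> ` K \<subseteq> K" "finite (\<rho> ` K)"
    and close: "\<And>k n. k \<in> K \<Longrightarrow> n < N \<Longrightarrow> norm (\<alpha> k n - \<alpha> (\<rho> k) n) < d"
    using finite_cells[of K \<alpha> d N] d(1) by metis
  \<comment> \<open>A difference of two coefficient sequences is only known to have norm at most 4,
    so 1/16 reduces its tail to 1/4; with the head and the factor 2 this gives exactly 1.\<close>
  define b where "b n = (if n < N then M else 1 / 16)" for n
  have b: "0 < b n" for n
    using M by (simp add: b_def)
  define G where "G = (\<lambda>k. k - \<rho> k) ` K"
  have "p_bounded s' p e (J ` G)"
    unfolding p_bounded_def G_def image_image
  proof (intro exI conjI image_subsetI)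
    have head: "lp_le p (c / M) (\<lambda>n. (1 / M) *\<^sub>R w n)"
      using lp_le_scale[OF p w(1), of "1 / M" "\<lambda>n. (1 / M) *\<^sub>R w n"] M by simp
    have tail: "lp_le p (16 * (e / 64)) (\<lambda>n. 16 *\<^sub>R (if n < N then 0 else w n))"
      by (rule lp_le_scale[OF p N]) auto
    have "lp_le p (2 * (c / M + 16 * (e / 64))) (\<lambda>n. (1 / b n) *\<^sub>R w n)"
      by (rule lp_le_add[OF p head tail]) (use M in \<open>auto simp: b_def\<close>)
    then show "lp_le p e (\<lambda>n. (1 / b n) *\<^sub>R w n)"
    proof (rule lp_le_weaken)
      have "2 * (c / M + 16 * (e / 64)) \<le> 2 * (e / 4 + e / 4)"
        by (intro mult_left_mono add_mono M(2)) auto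
      then show "2 * (c / M + 16 * (e / 64)) \<le> e" by simp
    qed
    fix k assume k: "k \<in> K"
    then have \<rho>k: "\<rho> k \<in> K" using \<rho>(1) by blast
    define \<gamma> where "\<gamma> n = (\<alpha> k n - \<alpha> (\<rho> k) n) * of_real (b n)" for n
    have "lp_le (conj_exponent p) (2 * (1 + 1)) (\<lambda>n. \<alpha> k n - \<alpha> (\<rho> k) n)"
      by (rule lp_le_add[OF q \<alpha>(1)[OF k] \<alpha>(1)[OF \<rho>k]]) (rule norm_triangle_ineq4)
    then have tail: "lp_le (conj_exponent p) (1 / 16 * (2 * (1 + 1)))
        (\<lambda>n. (1 / 16) *\<^sub>R (\<alpha> k n - \<alpha> (\<rho> k) n))"
      by (rule lp_le_scale[OF q]) auto
    let ?h = "\<lambda>n. if n < N then M *\<^sub>R (\<alpha> k n - \<alpha> (\<rho> k) n) else 0"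
    have "lp_le (conj_exponent p) (\<Sum>n<N. norm (?h n)) ?h"
      by (rule lp_le_finite_support[OF q]) simp
    moreover have "(\<Sum>n<N. norm (?h n)) \<le> 1 / 4"
    proof -
      have "(\<Sum>n<N. norm (?h n)) \<le> (\<Sum>n<N. M * d)"
      proof (rule sum_mono)
        fix n assume "n \<in> {..<N}"
        then have "M * norm (\<alpha> k n - \<alpha> (\<rho> k) n) \<le> M * d"
          using close[OF k, of n] M by (intro mult_left_mono) auto
        then show "norm (?h n) \<le> M * d"
          using M d(1) by simp
      qed
      then show ?thesis using d(2) by simp
    qed
    ultimately have head: "lp_le (conj_exponent p) (1 / 4) ?h"
      by (rule lp_le_weaken)
    have "lp_le (conj_exponent p) (2 * (1 / 4 + 1 / 16 * (2 * (1 + 1)))) \<gamma>"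
      by (rule lp_le_add[OF q head tail]) (use M in \<open>auto simp: \<gamma>_def b_def norm_mult\<close>)
    then have "lp_le (conj_exponent p) 1 \<gamma>"
      by simp
    moreover have "(\<lambda>n. s' (\<gamma> n) ((1 / b n) *\<^sub>R w n)) sums J (k - \<rho> k)"
    proof -
      have "s' (\<gamma> n) ((1 / b n) *\<^sub>R w n) = s' (\<alpha> k n) (w n) - s' (\<alpha> (\<rho> k) n) (w n)" for n
        unfolding \<gamma>_def using b[of n] by (subst F.s_rescale) (auto simp: F.s_diff_left)
      then show ?thesis
        using sums_diff[OF \<alpha>(2)[OF k] \<alpha>(2)[OF \<rho>k]] by (simp add: J_diff)
    qed
    ultimately show "J (k - \<rho> k) \<in> p_hull s' p (\<lambda>n. (1 / b n) *\<^sub>R w n)"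
      by (auto simp: mem_p_hull_iff)
  qed
  moreover have "p_bounded s p (c + e) (\<rho> ` K)"
    using p_bounded_subset[OF K image_mono[OF \<rho>(1)]] by (rule finite_transfer[OF p \<rho>(2) _ e])
  ultimately show thesis
    by (intro that[of "\<rho> ` K" G]) (auto simp: G_def)
qed

text \<open>Each \<open>k\<close> in \<open>K\<close> is followed through remainders
  \<open>g j\<close> in \<open>G j\<close>, and consecutive differences lie in sets
  \<open>F j\<close> already bounded in E. The weights then give the cost of the sum of all
  \<open>F j\<close>.\<close>

theorem p_bounded_transfer:
  assumes p: "1 \<le> p" and K: "p_bounded s' p c (J ` K)" and e: "0 < e"
  shows "p_bounded s p (c + e) K"
proof -
  obtain t where t: "0 < t" "t < 1" "(c + t\<^sup>2) / (1 - t) + 5 * t \<le> c + e"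
    using small_total[OF e] by blast
  \<comment> \<open>For j \<ge> 1 the cost of \<open>F j\<close> is \<eta> (j-1) + \<eta> j = 5 t^2
    / 4^j. Division by the weight t / 2^j leaves 5 t / 2^j, of total 5 t.\<close>
  define \<eta> where "\<eta> j = t\<^sup>2 * (1 / 4) ^ j" for j :: nat
  have \<eta>: "0 < \<eta> j" for j
    using t by (simp add: \<eta>_def)
  define r where "r j = (if j = 0 then c else \<eta> (j - 1))" for j
  \<comment> \<open>The second conjunct ties the start of the dependent choice to \<open>K\<close>,
    with \<open>c\<close> itself as the initial bound.\<close>
  let ?P = "\<lambda>j G. p_bounded s' p (r j) (J ` G) \<and> (j = 0 \<longrightarrow> G = K)"
  let ?Q = "\<lambda>j G G'. \<exists>F. p_bounded s p (r j + \<eta> j) F \<and> (\<forall>k\<in>G. \<exists>f\<in>F. k - f \<in> G')"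
  have "\<exists>G. \<forall>j. ?P j (G j) \<and> ?Q j (G j) (G (Suc j))"
  proof (rule dependent_nat_choice)
    show "\<exists>G. ?P 0 G"
      using K by (auto simp: r_def)
    fix G j assume "?P j G"
    then have "p_bounded s' p (r j) (J ` G)" by simp
    then obtain F G' where "p_bounded s p (r j + \<eta> j) F" "p_bounded s' p (\<eta> j) (J ` G')"
      "\<And>k. k \<in> G \<Longrightarrow> \<exists>f\<in>F. k - f \<in> G'"
      by (rule finite_plus_small[OF p _ \<eta>, of "r j" G j]) blast
    then show "\<exists>G'. ?P (Suc j) G' \<and> ?Q j G G'"
      by (intro exI[of _ G']) (auto simp: r_def)
  qed
  then obtain G where G: "\<And>j. ?P j (G j)" "\<And>j. ?Q j (G j) (G (Suc j))" by blast
  obtain F where F: "\<And>j. p_bounded s p (r j + \<eta> j) (F j)"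
    "\<And>j k. k \<in> G j \<Longrightarrow> \<exists>f\<in>F j. k - f \<in> G (Suc j)"
    using G(2) by metis
  \<comment> \<open>The bound for \<open>G j\<close> is known only in E''; since \<open>J\<close> is
    isometric, it controls the norm in E as well.\<close>
  have G_norm: "norm y \<le> r j" if "y \<in> G j" for y j
  proof -
    obtain w where w: "lp_le p (r j) w" "J ` G j \<subseteq> p_hull s' p w"
      using G(1)[of j] by (auto simp: p_bounded_def)
    then show ?thesis
      using F.p_hull_norm_le[OF p w(1), of "J y"] that norm_J[of y] by auto
  qed
  have "(\<lambda>j. \<eta> j) \<longlonglongrightarrow> t\<^sup>2 * 0"
    unfolding \<eta>_def by (intro tendsto_mult tendsto_const LIMSEQ_realpow_zero) auto
  then have r_lim: "r \<longlonglongrightarrow> 0"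
    by (subst filterlim_sequentially_Suc[symmetric]) (simp add: r_def)
  have total: "(\<lambda>j. (r j + \<eta> j) / weight t j) sums ((c + t\<^sup>2) / (1 - t) + 5 * t)"
  proof -
    have terms: "(r (Suc j) + \<eta> (Suc j)) / weight t (Suc j) = 5 * t * (1 / 2) ^ Suc j" for j
    proof -
      have "(4 :: real) ^ j = 2 ^ j * 2 ^ j"
        by (simp flip: power_mult_distrib)
      then show ?thesis
        using t by (simp add: r_def \<eta>_def weight_def field_simps power2_eq_square)
    qed
    have "(\<lambda>j. (r (Suc j) + \<eta> (Suc j)) / weight t (Suc j)) sums (5 * t)"
      unfolding terms using sums_mult[OF geometric_sums[of "1 / 2 :: real"], of "5 * t / 2"] by simp
    then show ?thesis
      by (subst (asm) sums_Suc_iff) (simp add: r_def \<eta>_def weight_def algebra_simps)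
  qed
  have "p_bounded s p ((c + t\<^sup>2) / (1 - t) + 5 * t) {y. \<exists>a. (\<forall>j. a j \<in> F j) \<and> a sums y}"
    by (rule E.p_bounded_sums[OF p F(1) weight_pos[OF t(1,2)] weight_sums total])
  moreover have "K \<subseteq> {y. \<exists>a. (\<forall>j. a j \<in> F j) \<and> a sums y}"
  proof
    fix k assume k: "k \<in> K"
    have "\<exists>g. \<forall>j. (g j \<in> G j \<and> (j = 0 \<longrightarrow> g j = k)) \<and> g j - g (Suc j) \<in> F j"
    proof (rule dependent_nat_choice)
      show "\<exists>x. x \<in> G 0 \<and> (0 = 0 \<longrightarrow> x = k)"
        using k G(1)[of 0] by auto
      fix x j assume "x \<in> G j \<and> (j = 0 \<longrightarrow> x = k)"
      then obtain f where "f \<in> F j" "x - f \<in> G (Suc j)"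
        using F(2) by blast
      then show "\<exists>y. (y \<in> G (Suc j) \<and> (Suc j = 0 \<longrightarrow> y = k)) \<and> x - y \<in> F j"
        by (intro exI[of _ "x - f"]) auto
    qed
    then obtain g where g: "\<And>j. g j \<in> G j" "g 0 = k" "\<And>j. g j - g (Suc j) \<in> F j"
      by metis
    have "g \<longlonglongrightarrow> 0"
      by (rule Lim_null_comparison[OF _ r_lim]) (use G_norm g(1) in auto)
    then have "(\<lambda>j. g j - g (Suc j)) sums (g 0 - 0)"
      by (rule telescope_sums')
    then show "k \<in> {y. \<exists>a. (\<forall>j. a j \<in> F j) \<and> a sums y}"
      using g(2,3) by (intro CollectI exI[of _ "\<lambda>j. g j - g (Suc j)"]) auto
  qed
  ultimately show ?thesis
    using t(3) by (meson p_bounded_subset p_bounded_weaken)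
qed

lemma p_compact_transfer:
  assumes p: "1 \<le> p"
  shows "p_compact s p K \<longleftrightarrow> p_compact s' p (J ` K)"
  unfolding p_compact_iff_p_bounded
  using p_bounded_image[OF p] p_bounded_transfer[OF p _ zero_less_one] by blast

lemma p_measure_transfer:
  assumes p: "1 \<le> p"
  shows "p_measure s p K = p_measure s' p (J ` K)"
  unfolding p_measure_eq_Inf_p_bounded
proof (rule antisym)
  show "Inf {ennreal c | c. p_bounded s' p c (J ` K)} \<le> Inf {ennreal c | c. p_bounded s p c K}"
    by (rule Inf_superset_mono) (use p_bounded_image[OF p] in blast)
  show "Inf {ennreal c | c. p_bounded s p c K} \<le> Inf {ennreal c | c. p_bounded s' p c (J ` K)}"
  proof (rule Inf_greatest, clarify)
    fix c assume c: "p_bounded s' p c (J ` K)"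
    show "Inf {ennreal c | c. p_bounded s p c K} \<le> ennreal c"
    proof (rule ennreal_le_epsilon)
      fix e :: real assume e: "0 < e"
      have "Inf {ennreal c | c. p_bounded s p c K} \<le> ennreal (c + e)"
        using p_bounded_transfer[OF p c e] by (intro Inf_lower) blast
      then show "Inf {ennreal c | c. p_bounded s p c K} \<le> ennreal c + ennreal e"
        using p_bounded_nonneg[OF c] e by simp
    qed
  qed
qed

end

section \<open>Real and complex scalars\<close>

interpretation scaleR: scalar_action "scaleR :: real \<Rightarrow> 'a::banach \<Rightarrow> 'a"
  by standard (simp_all add: algebra_simps)

text \<open>The extension of \<open>f\<close> to E'' is evaluation at \<open>f\<close>, that is, the
  image of \<open>f\<close> under the embedding of E' into E'''. Hence \<open>bidual_embed\<close>
  occurs twice, at different types.\<close>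

interpretation real_bidual: functional_extension
  "scaleR :: real \<Rightarrow> 'a::banach \<Rightarrow> 'a" scaleR bidual_embed bidual_embed
proof (intro functional_extension.intro functional_extension_axioms.intro scaleR.scalar_action_axioms)
  have apply_embed: "blinfun_apply (bidual_embed x) f = blinfun_apply f x" for x :: "'b::banach" and f
    by (simp add: bidual_embed.rep_eq)
  have norm_embed: "norm (bidual_embed x) \<le> norm x" for x :: "'b::banach"
    by (rule norm_blinfun_bound) (use norm_blinfun[of "_ :: _ \<Rightarrow>\<^sub>L real" x] in \<open>simp_all add: apply_embed mult.commute\<close>)
  show "norm (bidual_embed x) \<le> norm x" for x :: 'a
    by (rule norm_embed)
  show "norm (bidual_embed f) \<le> norm f" for f :: "'a \<Rightarrow>\<^sub>L real"
    by (rule norm_embed)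
  show "bounded_linear (bidual_embed :: 'a \<Rightarrow> _)"
    by (rule bounded_linear_intro[of _ 1])
      (auto intro!: blinfun_eqI norm_embed simp: apply_embed blinfun.add_right blinfun.scaleR_right
        blinfun.add_left blinfun.scaleR_left)
  show "bidual_embed (c *\<^sub>R x) = c *\<^sub>R bidual_embed x" for c and x :: 'a
    by (auto intro!: blinfun_eqI simp: apply_embed blinfun.scaleR_right blinfun.scaleR_left)
  show "bidual_embed (f + g) = bidual_embed f + bidual_embed g" for f g :: "'a \<Rightarrow>\<^sub>L real"
    by (auto intro!: blinfun_eqI simp: apply_embed blinfun.add_right blinfun.add_left)
  show "blinfun_apply (bidual_embed f) (bidual_embed x) = blinfun_apply f x"
    for f :: "'a \<Rightarrow>\<^sub>L real" and x
    by (simp add: apply_embed)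
  show "blinfun_apply (bidual_embed g) y = blinfun_apply (bidual_embed f) (c *\<^sub>R y)"
    if "\<And>x. blinfun_apply g x = blinfun_apply f (c *\<^sub>R x)" for f g :: "'a \<Rightarrow>\<^sub>L real" and c y
  proof -
    have "g = c *\<^sub>R f"
      by (rule blinfun_eqI) (simp add: that blinfun.scaleR_right blinfun.scaleR_left)
    then show ?thesis
      by (simp add: apply_embed blinfun.scaleR_right blinfun.scaleR_left)
  qed
qed

section \<open>Complex duals and extension of real functionals\<close>

lemma cdual_apply_add_left: "cdual_apply (f + g) x = cdual_apply f x + cdual_apply g x"
  by transfer (simp add: blinfun.add_left)

lemma cdual_apply_scaleC_left: "cdual_apply (c *\<^sub>C f) x = c * cdual_apply f x"
  by transfer simp

lemma cdual_apply_scaleC_right: "cdual_apply f (c *\<^sub>C x) = c * cdual_apply f x"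
  by transfer simp

lemma norm_cdual_apply: "norm (cdual_apply f x) \<le> norm f * norm x"
  by transfer (rule norm_blinfun)

lemma bounded_linear_cdual_apply_right: "bounded_linear (cdual_apply f)"
  by transfer (rule blinfun.bounded_linear_right)

lemma cdual_eqI: "(\<And>x. cdual_apply f x = cdual_apply g x) \<Longrightarrow> f = g"
  by transfer (rule blinfun_eqI)

lemma norm_cdual_bound:
  "0 \<le> b \<Longrightarrow> (\<And>x. norm (cdual_apply f x) \<le> b * norm x) \<Longrightarrow> norm f \<le> b"
  by transfer (rule norm_blinfun_bound)

interpretation scaleC: scalar_action "scaleC :: complex \<Rightarrow> 'a::complex_banach \<Rightarrow> 'a"
  by standard (simp_all add: scaleC_add_right scaleC_add_left scaleC_scaleC scaleC_of_real norm_scaleC)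

text \<open>The complex-linear functional with a given real part.\<close>

definition complexify :: "('a::complex_banach \<Rightarrow>\<^sub>L real) \<Rightarrow> 'a cdual" where
  "complexify f = Abs_cdual (Blinfun
    (\<lambda>x. complex_of_real (blinfun_apply f x) - \<i> * complex_of_real (blinfun_apply f (\<i> *\<^sub>C x))))"

lemma complexify_apply:
  fixes f :: "'a::complex_banach \<Rightarrow>\<^sub>L real"
  shows "cdual_apply (complexify f) x
    = complex_of_real (blinfun_apply f x) - \<i> * complex_of_real (blinfun_apply f (\<i> *\<^sub>C x))"
proof -
  let ?h = "\<lambda>x. complex_of_real (blinfun_apply f x) - \<i> * complex_of_real (blinfun_apply f (\<i> *\<^sub>C x))"
  have "bounded_linear ?h"
    by (intro bounded_linear_sub bounded_linear_const_mult
        bounded_linear_compose[OF bounded_linear_of_real]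
        bounded_linear_compose[OF blinfun.bounded_linear_right scaleC.bounded_linear_s]
        blinfun.bounded_linear_right)
  then have h: "blinfun_apply (Blinfun ?h) = ?h"
    by (rule bounded_linear_Blinfun_apply)
  have "?h (c *\<^sub>C x) = c * ?h x" for c x
  proof -
    have c: "c *\<^sub>C y = Re c *\<^sub>R y + Im c *\<^sub>R (\<i> *\<^sub>C y)" for y :: 'a
    proof -
      have "c = complex_of_real (Re c) + complex_of_real (Im c) * \<i>"
        by (simp add: complex_eq_iff)
      then have "c *\<^sub>C y = (complex_of_real (Re c) + complex_of_real (Im c) * \<i>) *\<^sub>C y"
        by (rule arg_cong)
      then show ?thesis
        by (simp only: scaleC_add_left scaleC_of_real flip: scaleC_scaleC)
    qed
    have ii: "\<i> *\<^sub>C \<i> *\<^sub>C x = - x"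
      using scaleC_of_real[of "-1" x] by (simp add: scaleC_scaleC)
    have "\<i> *\<^sub>C c *\<^sub>C x = c *\<^sub>C \<i> *\<^sub>C x"
      by (simp add: scaleC_scaleC mult.commute)
    also have "\<dots> = Re c *\<^sub>R (\<i> *\<^sub>C x) - Im c *\<^sub>R x"
      unfolding c[of "\<i> *\<^sub>C x"] ii by simp
    finally have "blinfun_apply f (\<i> *\<^sub>C c *\<^sub>C x)
        = Re c * blinfun_apply f (\<i> *\<^sub>C x) - Im c * blinfun_apply f x"
      by (simp add: blinfun.diff_right blinfun.scaleR_right)
    moreover have "blinfun_apply f (c *\<^sub>C x)
        = Re c * blinfun_apply f x + Im c * blinfun_apply f (\<i> *\<^sub>C x)"
      unfolding c[of x] by (simp add: blinfun.add_right blinfun.scaleR_right)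
    ultimately show ?thesis
      by (simp add: complex_eq_iff)
  qed
  then have "cdual_blinfun (Abs_cdual (Blinfun ?h)) = Blinfun ?h"
    by (intro Abs_cdual_inverse) (simp add: h)
  then show ?thesis
    by (simp add: complexify_def cdual_apply.rep_eq h)
qed

lemma Re_complexify: "Re (cdual_apply (complexify f) x) = blinfun_apply f x"
  by (simp add: complexify_apply)

text \<open>Rotating \<open>x\<close> by a unimodular \<open>u\<close> makes the value real and
  nonnegative; there it equals its real part, which is \<open>f\<close> at the rotated
  vector.\<close>

lemma norm_complexify_le: "norm (complexify f) \<le> norm f"
proof (rule norm_cdual_bound)
  fix x
  let ?z = "cdual_apply (complexify f) x"
  show "norm ?z \<le> norm f * norm x"
  proof (cases "?z = 0")
    case False
    define u where "u = cnj (sgn ?z)"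
    have u: "norm u = 1"
      using False by (simp add: u_def norm_sgn)
    have "complex_of_real (norm ?z) = u * ?z"
      using False by (simp add: u_def sgn_eq complex_norm_square power2_eq_square mult.commute
          flip: complex_norm_square)
    then have "norm ?z = Re (cdual_apply (complexify f) (u *\<^sub>C x))"
      by (metis Re_complex_of_real cdual_apply_scaleC_right)
    also have "\<dots> \<le> norm f * norm (u *\<^sub>C x)"
      unfolding Re_complexify using norm_blinfun[of f "u *\<^sub>C x"] by simp
    finally show ?thesis
      by (simp add: norm_scaleC u)
  qed simp
qed simp

text \<open>The dual of a complex space holds complex-linear functionals only, so elements of E''
  are evaluated at the complexification of \<open>f\<close>; the real part extends
  \<open>f\<close>.\<close>

lift_definition cextend :: "('a::complex_banach \<Rightarrow>\<^sub>L real) \<Rightarrow> ('a cdual cdual \<Rightarrow>\<^sub>L real)" is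
  "\<lambda>f y. Re (cdual_apply y (complexify f))"
  by (rule bounded_linear_compose[OF bounded_linear_Re bounded_linear_cdual_apply])

interpretation complex_bidual: functional_extension
  "scaleC :: complex \<Rightarrow> 'a::complex_banach \<Rightarrow> 'a" scaleC cbidual_embed cextend
proof (intro functional_extension.intro functional_extension_axioms.intro scaleC.scalar_action_axioms)
  have norm_embed: "norm (cbidual_embed x) \<le> norm x" for x :: 'a
    by (rule norm_cdual_bound) (use norm_cdual_apply in \<open>auto simp: cbidual_embed_apply mult.commute\<close>)
  then show "norm (cbidual_embed x) \<le> norm x" for x :: 'a .
  show J_s: "cbidual_embed (c *\<^sub>C x) = c *\<^sub>C cbidual_embed x" for c and x :: 'a
    by (rule cdual_eqI)
      (simp add: cbidual_embed_apply cdual_apply_scaleC_left cdual_apply_scaleC_right)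
  show "bounded_linear (cbidual_embed :: 'a \<Rightarrow> _)"
  proof (rule bounded_linear_intro[of _ 1])
    show "cbidual_embed (x + y) = cbidual_embed x + cbidual_embed y" for x y :: 'a
      by (rule cdual_eqI) (simp add: cbidual_embed_apply cdual_apply_add_left
          linear_add[OF bounded_linear.linear[OF bounded_linear_cdual_apply_right]])
    show "cbidual_embed (r *\<^sub>R x) = r *\<^sub>R cbidual_embed x" for r and x :: 'a
      by (metis J_s scaleC_of_real)
  qed (simp add: norm_embed)
  show "cextend (f + g) = cextend f + cextend g" for f g :: "'a \<Rightarrow>\<^sub>L real"
  proof (rule blinfun_eqI)
    fix y :: "'a cdual cdual"
    have "complexify (f + g) = complexify f + complexify g"
      by (rule cdual_eqI) (simp add: complexify_apply cdual_apply_add_left blinfun.add_left algebra_simps)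
    then show "blinfun_apply (cextend (f + g)) y = blinfun_apply (cextend f + cextend g) y"
      by (simp add: cextend.rep_eq blinfun.add_left
          linear_add[OF bounded_linear.linear[OF bounded_linear_cdual_apply_right]])
  qed
  show "norm (cextend f) \<le> norm f" for f :: "'a \<Rightarrow>\<^sub>L real"
  proof (rule norm_blinfun_bound)
    fix y :: "'a cdual cdual"
    have "norm (blinfun_apply (cextend f) y) \<le> norm (cdual_apply y (complexify f))"
      by (simp add: cextend.rep_eq abs_Re_le_cmod)
    also have "\<dots> \<le> norm y * norm (complexify f)"
      by (rule norm_cdual_apply)
    also have "\<dots> \<le> norm y * norm f"
      by (intro mult_left_mono norm_complexify_le) simp
    finally show "norm (blinfun_apply (cextend f) y) \<le> norm f * norm y"
      by (simp add: mult.commute)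
  qed simp
  show "blinfun_apply (cextend f) (cbidual_embed x) = blinfun_apply f x"
    for f :: "'a \<Rightarrow>\<^sub>L real" and x
    by (simp add: cextend.rep_eq cbidual_embed_apply Re_complexify)
  show "blinfun_apply (cextend g) y = blinfun_apply (cextend f) (c *\<^sub>C y)"
    if "\<And>x. blinfun_apply g x = blinfun_apply f (c *\<^sub>C x)" for f g :: "'a \<Rightarrow>\<^sub>L real" and c y
  proof -
    \<comment> \<open>Composing with multiplication by \<open>c\<close> on E becomes multiplication
      by \<open>c\<close> in E', after which complex linearity of \<open>y\<close> gives the
      claim.\<close>
    have "complexify g = c *\<^sub>C complexify f"
    proof (rule cdual_eqI)
      fix x
      have "cdual_apply (c *\<^sub>C complexify f) x = cdual_apply (complexify f) (c *\<^sub>C x)"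
        by (simp add: cdual_apply_scaleC_left cdual_apply_scaleC_right)
      also have "\<dots> = cdual_apply (complexify g) x"
        by (simp add: complexify_apply that scaleC_scaleC mult.commute)
      finally show "cdual_apply (complexify g) x = cdual_apply (c *\<^sub>C complexify f) x" ..
    qed
    then show ?thesis
      by (simp add: cextend.rep_eq cdual_apply_scaleC_left cdual_apply_scaleC_right)
  qed
qed

theorem theorem2p4:
  fixes p :: ennreal
    and K :: "'a::banach set"
    and L :: "'b::complex_banach set"
  assumes "1 \<le> p"
  shows "((p_compact scaleR p K \<longleftrightarrow> p_compact scaleR p (bidual_embed ` K)) \<and>
          p_measure scaleR p K = p_measure scaleR p (bidual_embed ` K)) \<and>
         ((p_compact scaleC p L \<longleftrightarrow> p_compact scaleC p (cbidual_embed ` L)) \<and>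
          p_measure scaleC p L = p_measure scaleC p (cbidual_embed ` L))"
  using real_bidual.p_compact_transfer[OF assms] real_bidual.p_measure_transfer[OF assms]
    complex_bidual.p_compact_transfer[OF assms] complex_bidual.p_measure_transfer[OF assms]
  by blast

end
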